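(* Fix $p\in(0,1)$. Let $\mathcal E(S_n)$ denote the expected number of steps for the Ungarian Markov chain of the weak order on the symmetric group $S_n$ to go from the top element $n(n-1)\cdots 1$ to the bottom element $12\cdots n$. Then, as $n\to\infty$, \[n-1+o(1)\leq\mathcal E(S_n)\leq \frac{8}{p}n\log n+O(n).\]
   Context: All lattices are finite. For a lattice $L$ and $x\in L$, let $\mathrm{cov}_L(x)$ be the set of elements covered by $x$. Fix a probability $p$. The Ungarian Markov chain ${\bf U}_L$ has state space $L$: from state $x$, form a random subset $T\subseteq\mathrm{cov}_L(x)$ by including each element independently with probability $p$, and move to $\bigwedge(\{x\}\cup T)$. $\mathcal E(L)$ denotes the expected number of steps needed to reach the bottom element $\hat 0$ when starting at the top element $\hat 1$. The (right) weak order on $S_n$ is the partial order generated by the cover relations $w\lessdot ws_i$ whenever $i$ is a descent of $ws_i$, where $s_i=(i\ i+1)$ and $i\in[n-1]$ is a descent of $w'$ if $w'(i)>w'(i+1)$; it is a lattice. Concretely, a step of ${\bf U}_{S_n}$ from $x$ picks each descent of $x$ independently with probability $p$ and reverses the maximal consecutive decreasing blocks formed by the chosen descents. *)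

theory Defs
  imports
    "HOL-Probability.Probability"
    "HOL-Algebra.Lattice"
    "HOL-Combinatorics.Permutations"
    "HOL-Library.Landau_Symbols"
begin

text \<open>
  The law, on the space of trajectories \<open>\<omega> :: nat \<Rightarrow> 'a\<close>, of the time-homogeneous Markov chain with
  transition probabilities \<open>K\<close> and initial state \<open>x\<^sub>0\<close>, obtained from the Ionescu-Tulcea theorem.
  The value \<open>\<omega> i\<close> is the state after \<open>i\<close> steps.
\<close>

definition markov_kernel :: "('a \<Rightarrow> 'a pmf) \<Rightarrow> 'a \<Rightarrow> nat \<Rightarrow> (nat \<Rightarrow> 'a) \<Rightarrow> 'a measure" where
  "markov_kernel K x\<^sub>0 i \<omega> =
     measure_pmf (case i of 0 \<Rightarrow> return_pmf x\<^sub>0 | Suc j \<Rightarrow> K (\<omega> j))"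

global_interpretation markov: Ionescu_Tulcea "markov_kernel K x\<^sub>0" "\<lambda>_. count_space UNIV"
  for K :: "'a \<Rightarrow> 'a pmf" and x\<^sub>0 :: 'a
proof (rule Ionescu_Tulcea.intro)
  fix i :: nat
  show "markov_kernel K x\<^sub>0 i
      \<in> Pi\<^sub>M {0..<i} (\<lambda>_. count_space UNIV) \<rightarrow>\<^sub>M subprob_algebra (count_space UNIV)"
  proof (cases i)
    case 0
    then show ?thesis
      by (simp add: markov_kernel_def[abs_def])
  next
    case (Suc j)
    have "(\<lambda>\<omega>. \<omega> j) \<in> Pi\<^sub>M {0..<i} (\<lambda>_. count_space UNIV) \<rightarrow>\<^sub>M count_space (UNIV :: 'a set)"
      using Suc by (intro measurable_component_singleton) auto
    moreover have "(\<lambda>x. measure_pmf (K x)) \<in> count_space UNIV \<rightarrow>\<^sub>M subprob_algebra (count_space UNIV)"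
      by (simp add: measure_pmf_in_subprob_algebra)
    ultimately show ?thesis
      using Suc measurable_compose by (fastforce simp: markov_kernel_def[abs_def])
  qed
next
  show "prob_space (markov_kernel K x\<^sub>0 i \<omega>)" for i \<omega>
    by (simp add: markov_kernel_def measure_pmf.prob_space_axioms)
qed

definition markov_law :: "('a \<Rightarrow> 'a pmf) \<Rightarrow> 'a \<Rightarrow> (nat \<Rightarrow> 'a) measure" where
  "markov_law K x\<^sub>0 = markov.PF.lim K x\<^sub>0"

definition hitting_time :: "'a \<Rightarrow> (nat \<Rightarrow> 'a) \<Rightarrow> enat" where
  "hitting_time y \<omega> = Inf {enat t |t. \<omega> t = y}"

definition covered_set :: "('a, 'b) gorder_scheme \<Rightarrow> 'a \<Rightarrow> 'a set" where
  "covered_set L x =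
     {y \<in> carrier L. y \<sqsubset>\<^bsub>L\<^esub> x \<and> \<not> (\<exists>z\<in>carrier L. y \<sqsubset>\<^bsub>L\<^esub> z \<and> z \<sqsubset>\<^bsub>L\<^esub> x)}"

text \<open>
  The random subset \<open>T\<close> is encoded by its indicator function \<open>f\<close>, whose values on the set of covered
  elements are independent Bernoulli variables.
\<close>

definition ungarian_step :: "real \<Rightarrow> ('a, 'b) gorder_scheme \<Rightarrow> 'a \<Rightarrow> 'a pmf" where
  "ungarian_step p L x =
     map_pmf (\<lambda>f. let T = {y \<in> covered_set L x. f y} in \<Sqinter>\<^bsub>L\<^esub> ({x} \<union> T))
       (Pi_pmf (covered_set L x) False (\<lambda>_. bernoulli_pmf p))"

definition ungarian_expected_steps :: "real \<Rightarrow> ('a, 'b) gorder_scheme \<Rightarrow> ennreal" where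
  "ungarian_expected_steps p L =
     (\<integral>\<^sup>+\<omega>. ennreal_of_enat (hitting_time \<bottom>\<^bsub>L\<^esub> \<omega>) \<partial>markov_law (ungarian_step p L) \<top>\<^bsub>L\<^esub>)"

definition descents :: "nat \<Rightarrow> (nat \<Rightarrow> nat) \<Rightarrow> nat set" where
  "descents n w = {i \<in> {1..<n}. w i > w (Suc i)}"

text \<open>
  An element of the symmetric group is a function on \<open>nat\<close> that permutes \<open>{1..n}\<close> and fixes everything else.
\<close>

definition weak_cover :: "nat \<Rightarrow> (nat \<Rightarrow> nat) \<Rightarrow> (nat \<Rightarrow> nat) \<Rightarrow> bool" where
  "weak_cover n w w' \<longleftrightarrow>
     (\<exists>i\<in>{1..<n}. w' = w \<circ> Transposition.transpose i (Suc i) \<and> i \<in> descents n w')"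

definition weak_order :: "nat \<Rightarrow> (nat \<Rightarrow> nat) gorder" where
  "weak_order n =
     \<lparr>carrier = {w. w permutes {1..n}}, eq = (=), le = (weak_cover n)\<^sup>*\<^sup>*\<rparr>"

end

theory Submission
  imports Defs "HOL-Real_Asymp.Real_Asymp"
begin

text \<open>
  Upper bound.  For each level \<open>k\<close> the 0-1 word recording which entries exceed \<open>k\<close> is a Young diagram
  that shrinks along the chain and loses each of its corners with probability at least \<open>p\<close>.  Give the
  cell \<open>(i, j)\<close> the weight \<open>2 ^ (i + j)\<close>.  Every cell is dominated by a corner, so by a geometric series
  the corners carry at least a quarter of the total weight.  Hence the total weight decreases in
  expectation by the factor \<open>1 - p / 4\<close> in each step; as it is \<open>exp (O(n))\<close> initially and at least 1
  away from the identity, the expected number of steps is even \<open>O(n)\<close>.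

  Lower bound.  This is Ungar's theorem: a sequence of moves from the top to the bottom that never jumps
  from the top to the bottom directly has at least \<open>2 (n div 2)\<close> moves.  One considers the moves in
  which entries cross the middle; between consecutive crossings of orders \<open>d\<close> and \<open>d'\<close> at least
  \<open>d + d' - 1\<close> other moves are needed, also cyclically, and the orders add up to at least \<open>n div 2\<close>.  For
  odd \<open>n\<close> the two barriers next to the middle position are treated simultaneously.  The direct jump has
  probability at most \<open>p ^ (n - 1)\<close>.
\<close>

section \<open>Hitting times of Markov chains\<close>

text \<open>A corner may dominate about n^2 cells, so an unweighted count of cells could lose only a
  tiny fraction of itself per move. Weights that double along both axes make one corner comparable
  to its whole rectangle. The price, a starting potential of exp (O(n)), enters the time bound only
  through its logarithm, and summing over all levels costs just a polynomial factor in it.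

  The gap between crossings arises as follows. A crossing of order d leaves the d entries on either
  side of the barrier increasing, while the next one, of order d', needs the d' entries on either
  side decreasing. Moves reverse decreasing blocks, so a move can disturb an increasing window only
  at its two ends; hence such a window erodes, and a decreasing one grows, by at most one entry per
  side and move.

  For the cyclic gap the values cannot serve as labels, because mirrored moves reverse increasing
  blocks. Positions at a fixed time can.\<close>

primrec chain_pmf :: "('a \<Rightarrow> 'a pmf) \<Rightarrow> 'a \<Rightarrow> nat \<Rightarrow> 'a pmf" where
  "chain_pmf K x\<^sub>0 0 = return_pmf x\<^sub>0"
| "chain_pmf K x\<^sub>0 (Suc t) = bind_pmf (chain_pmf K x\<^sub>0 t) K"

text \<open>Only the last kernel acts on the last coordinate, so integrating it out leaves a shorter
  chain. There are \<open>Suc t\<close> kernels because coordinate 0 already takes one, the point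
  mass at the start.\<close>

lemma nn_integral_markov_C:
  "(\<integral>\<^sup>+\<omega>. f (\<omega> t) \<partial>markov.C K x\<^sub>0 0 (Suc t) (\<lambda>_. undefined)) =
     (\<integral>\<^sup>+y. f y \<partial>measure_pmf (chain_pmf K x\<^sub>0 t))"
proof (induction t arbitrary: f)
  let ?P = "\<lambda>t. PiM {0..<t} (\<lambda>_. count_space (UNIV :: 'a set))"
  let ?u = "\<lambda>_::nat. undefined :: 'a"
  have u: "?u \<in> space (?P 0)"
    by (simp add: space_PiM)
  have [measurable]: "(\<lambda>\<omega>. f (\<omega> i)) \<in> borel_measurable (?P (Suc i))" for i and f :: "'a \<Rightarrow> ennreal"
  proof -
    have "(\<lambda>\<omega>. \<omega> i) \<in> ?P (Suc i) \<rightarrow>\<^sub>M count_space UNIV"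
      by (rule measurable_component_singleton) auto
    then show ?thesis
      by (rule measurable_compose) simp
  qed
  have bind: "(\<integral>\<^sup>+\<omega>. f (\<omega> t) \<partial>markov.C K x\<^sub>0 0 (Suc t) ?u) =
     (\<integral>\<^sup>+\<omega>. (\<integral>\<^sup>+y. f y \<partial>markov_kernel K x\<^sub>0 t \<omega>) \<partial>markov.C K x\<^sub>0 0 t ?u)"
    for t and f :: "'a \<Rightarrow> ennreal"
  proof -
    have "(\<integral>\<^sup>+\<omega>. f (\<omega> t) \<partial>markov.C K x\<^sub>0 0 (Suc t) ?u) =
       (\<integral>\<^sup>+\<omega>. (\<integral>\<^sup>+\<omega>'. f (\<omega>' t) \<partial>markov.eP K x\<^sub>0 t \<omega>) \<partial>markov.C K x\<^sub>0 0 t ?u)"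
      unfolding markov.C.simps
      using markov.sets_C[OF u, of K x\<^sub>0 t] markov.measurable_eP[of K x\<^sub>0 t]
      by (subst nn_integral_bind[where B = "?P (Suc t)"]) (auto cong: measurable_cong_sets)
    also have "\<dots> = (\<integral>\<^sup>+\<omega>. (\<integral>\<^sup>+y. f y \<partial>markov_kernel K x\<^sub>0 t \<omega>) \<partial>markov.C K x\<^sub>0 0 t ?u)"
      using markov.space_C[OF u, of K x\<^sub>0 t]
      by (intro nn_integral_cong) (simp add: markov.nn_integral_eP)
    finally show ?thesis .
  qed
  {
    case 0
    show ?case
      unfolding bind by (simp add: markov_kernel_def markov.C.simps PiM_empty emeasure_return)
  next
    case (Suc t)
    show ?case
      unfolding bind
      by (simp add: markov_kernel_def Suc.IH[of "\<lambda>x. \<integral>\<^sup>+y. f y \<partial>measure_pmf (K x)"] del: markov.C.simps)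
  }
qed

lemma sets_markov_law [measurable_cong]:
  "sets (markov_law K x\<^sub>0) = sets (PiM UNIV (\<lambda>_. count_space UNIV))"
  by (simp add: markov_law_def)

lemma space_markov_law [simp]: "space (markov_law K x\<^sub>0) = UNIV"
  by (simp add: markov_law_def space_PiM)

lemma markov_law_component [measurable]:
  "(\<lambda>\<omega>. \<omega> t) \<in> markov_law K x\<^sub>0 \<rightarrow>\<^sub>M count_space UNIV"
  using measurable_component_singleton[of t UNIV "\<lambda>_. count_space UNIV"]
  by (simp cong: measurable_cong_sets add: sets_markov_law)

lemma sets_markov_law_component [measurable]:
  "{\<omega>. \<omega> t \<in> S} \<in> sets (markov_law K x\<^sub>0)"
  using measurable_sets[OF markov_law_component, of S t K x\<^sub>0] by (simp add: vimage_def)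

text \<open>The bridge from trajectories to \<open>chain_pmf\<close>. Both bounds on hitting times
  below are phrased through these one-time marginals.\<close>

lemma emeasure_markov_law:
  "emeasure (markov_law K x\<^sub>0) {\<omega>. \<omega> t \<in> S} = emeasure (measure_pmf (chain_pmf K x\<^sub>0 t)) S"
proof -
  let ?M = "\<lambda>_::nat. count_space (UNIV :: 'a set)"
  let ?u = "\<lambda>_::nat. undefined :: 'a"
  let ?X = "\<Pi>\<^sub>E i\<in>{t}. S"
  have X: "?X \<in> sets (PiM {t} ?M)"
    by (intro sets_PiM_I_finite) auto
  have u: "?u \<in> space (PiM {0..<0} ?M)"
    by (simp add: space_PiM)
  have emb: "prod_emb UNIV ?M {t} ?X = {\<omega>. \<omega> t \<in> S}"
    by (auto simp: prod_emb_def PiE_iff extensional_def)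
  have emb': "prod_emb {0..<Suc t} ?M {t} ?X = {\<omega> \<in> space (PiM {0..<Suc t} ?M). \<omega> t \<in> S}"
    by (auto simp: prod_emb_def PiE_iff extensional_def space_PiM)
  have "emeasure (markov_law K x\<^sub>0) {\<omega>. \<omega> t \<in> S} = emeasure (markov.CI K x\<^sub>0 {t}) ?X"
    unfolding markov_law_def emb[symmetric] using X by (intro markov.lim) auto
  also have "\<dots> = emeasure (markov.C K x\<^sub>0 0 (Suc t) ?u) {\<omega> \<in> space (PiM {0..<Suc t} ?M). \<omega> t \<in> S}"
    unfolding emb'[symmetric] using X by (intro markov.emeasure_CI) auto
  also have "\<dots> = (\<integral>\<^sup>+\<omega>. indicator {\<omega> \<in> space (PiM {0..<Suc t} ?M). \<omega> t \<in> S} \<omega>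
      \<partial>markov.C K x\<^sub>0 0 (Suc t) ?u)"
    using markov.sets_C[OF u, of K x\<^sub>0 "Suc t"] X
    by (subst nn_integral_indicator) (auto simp: emb'[symmetric] simp del: markov.C.simps)
  also have "\<dots> = (\<integral>\<^sup>+\<omega>. indicator S (\<omega> t) \<partial>markov.C K x\<^sub>0 0 (Suc t) ?u)"
    using markov.space_C[OF u, of K x\<^sub>0 "Suc t"]
    by (intro nn_integral_cong) (auto simp: indicator_def simp del: markov.C.simps)
  also have "\<dots> = emeasure (measure_pmf (chain_pmf K x\<^sub>0 t)) S"
    by (subst nn_integral_markov_C) simp
  finally show ?thesis .
qed

text \<open>Each time before the hitting time contributes 1 to the series. If \<open>y\<close> is
  never visited, the hitting time is infinite and the series must be shown to diverge.\<close>

lemma ennreal_of_enat_hitting_time_le: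
  "ennreal_of_enat (hitting_time y \<omega>) \<le> (\<Sum>t. indicator (- {y}) (\<omega> t))"
proof -
  have *: "ennreal_of_enat (enat n) \<le> (\<Sum>t. indicator (- {y}) (\<omega> t))"
    if "\<And>t. t < n \<Longrightarrow> \<omega> t \<noteq> y" for n
  proof -
    have "ennreal_of_enat (enat n) = (\<Sum>t<n. indicator (- {y}) (\<omega> t))"
      using that by (simp add: ennreal_of_enat_def)
    also have "\<dots> \<le> (\<Sum>t. indicator (- {y}) (\<omega> t))"
      by (rule sum_le_suminf) auto
    finally show ?thesis .
  qed
  show ?thesis
  proof (cases "\<exists>t. \<omega> t = y")
    case True
    define n where "n = (LEAST t. \<omega> t = y)"
    have "hitting_time y \<omega> = enat n"
      unfolding hitting_time_def n_def
    proof (rule antisym)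
      show "Inf {enat t |t. \<omega> t = y} \<le> enat (LEAST t. \<omega> t = y)"
        using True by (intro Inf_lower) (auto intro: LeastI)
      show "enat (LEAST t. \<omega> t = y) \<le> Inf {enat t |t. \<omega> t = y}"
        by (rule Inf_greatest) (auto intro: Least_le)
    qed
    moreover have "\<omega> t \<noteq> y" if "t < n" for t
      using that not_less_Least unfolding n_def by blast
    ultimately show ?thesis
      using *[of n] by simp
  next
    case False
    have "(\<Sum>t. indicator (- {y}) (\<omega> t)) = (\<infinity> :: ennreal)"
    proof (rule ccontr)
      assume "(\<Sum>t. indicator (- {y}) (\<omega> t)) \<noteq> (\<infinity> :: ennreal)"
      then obtain n :: nat where "(\<Sum>t. indicator (- {y}) (\<omega> t) :: ennreal) < of_nat n"
        using ennreal_Ex_less_of_nat[of "\<Sum>t. indicator (- {y}) (\<omega> t)"]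
        by (auto simp: infinity_ennreal_def less_top)
      then show False
        using *[of n] False unfolding ennreal_of_enat_def by (metis enat.simps(4) not_le)
    qed
    then show ?thesis
      by simp
  qed
qed

lemma hitting_time_ge:
  assumes "\<And>t. t < n \<Longrightarrow> \<omega> t \<noteq> y"
  shows "enat n \<le> hitting_time y \<omega>"
  unfolding hitting_time_def
proof (rule Inf_greatest)
  fix z assume "z \<in> {enat t |t. \<omega> t = y}"
  with assms show "enat n \<le> z"
    by (force simp: not_less[symmetric])
qed

lemma nn_integral_hitting_time_le:
  "(\<integral>\<^sup>+\<omega>. ennreal_of_enat (hitting_time y \<omega>) \<partial>markov_law K x\<^sub>0) \<le>
     (\<Sum>t. emeasure (measure_pmf (chain_pmf K x\<^sub>0 t)) (- {y}))"
proof -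
  have ind: "(\<lambda>\<omega>. indicator (- {y}) (\<omega> t)) = (indicator {\<omega>. \<omega> t \<in> - {y}} :: _ \<Rightarrow> ennreal)" for t
    by (auto simp: indicator_def)
  have "(\<integral>\<^sup>+\<omega>. ennreal_of_enat (hitting_time y \<omega>) \<partial>markov_law K x\<^sub>0) \<le>
      (\<integral>\<^sup>+\<omega>. (\<Sum>t. indicator {\<omega>. \<omega> t \<in> - {y}} \<omega>) \<partial>markov_law K x\<^sub>0)"
    using ennreal_of_enat_hitting_time_le
    by (intro nn_integral_mono) (simp add: indicator_def)
  also have "\<dots> = (\<Sum>t. \<integral>\<^sup>+\<omega>. indicator {\<omega>. \<omega> t \<in> - {y}} \<omega> \<partial>markov_law K x\<^sub>0)"
    by (intro nn_integral_suminf) measurable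
  also have "\<dots> = (\<Sum>t. emeasure (measure_pmf (chain_pmf K x\<^sub>0 t)) (- {y}))"
    unfolding emeasure_markov_law[symmetric]
    by (intro arg_cong[where f = suminf] ext nn_integral_indicator sets_markov_law_component)
  finally show ?thesis .
qed

lemma prob_space_markov_law: "prob_space (markov_law K x\<^sub>0)"
  using emeasure_markov_law[of K x\<^sub>0 0 UNIV] by (intro prob_spaceI) simp

text \<open>Outside the event \<open>H\<close> of a visit to \<open>y\<close> before time
  \<open>n\<close> the hitting time is at least \<open>n\<close>, and a union bound over the
  marginals controls \<open>H\<close>.\<close>

lemma nn_integral_hitting_time_ge:
  "ennreal (real n * (1 - (\<Sum>t<n. pmf (chain_pmf K x\<^sub>0 t) y))) \<le>
     (\<integral>\<^sup>+\<omega>. ennreal_of_enat (hitting_time y \<omega>) \<partial>markov_law K x\<^sub>0)"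
proof -
  interpret prob_space "markov_law K x\<^sub>0"
    by (rule prob_space_markov_law)
  define H where "H = (\<Union>t<n. {\<omega>. \<omega> t \<in> {y}})"
  have H: "H \<in> events"
    unfolding H_def by (intro sets.finite_UN sets_markov_law_component) auto
  have "prob H \<le> (\<Sum>t<n. prob {\<omega>. \<omega> t \<in> {y}})"
    unfolding H_def
    by (intro finite_measure_subadditive_finite image_subsetI sets_markov_law_component finite_lessThan)
  also have "\<dots> = (\<Sum>t<n. pmf (chain_pmf K x\<^sub>0 t) y)"
    unfolding measure_def emeasure_markov_law by (simp add: emeasure_pmf_single)
  finally have "1 - (\<Sum>t<n. pmf (chain_pmf K x\<^sub>0 t) y) \<le> prob (- H)"
    using prob_compl[OF H] by (simp add: Compl_eq_Diff_UNIV)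
  then have "ennreal (real n * (1 - (\<Sum>t<n. pmf (chain_pmf K x\<^sub>0 t) y))) \<le> ennreal (real n * prob (- H))"
    by (intro ennreal_leI mult_left_mono) auto
  also have "\<dots> = of_nat n * emeasure (markov_law K x\<^sub>0) (- H)"
    by (simp add: ennreal_mult emeasure_eq_measure ennreal_of_nat_eq_real_of_nat)
  also have "\<dots> = (\<integral>\<^sup>+\<omega>. of_nat n * indicator (- H) \<omega> \<partial>markov_law K x\<^sub>0)"
    using sets.compl_sets[OF H] by (subst nn_integral_cmult_indicator) (auto simp: Compl_eq_Diff_UNIV)
  also have "\<dots> \<le> (\<integral>\<^sup>+\<omega>. ennreal_of_enat (hitting_time y \<omega>) \<partial>markov_law K x\<^sub>0)"
  proof (intro nn_integral_mono)
    fix \<omega>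
    show "of_nat n * indicator (- H) \<omega> \<le> ennreal_of_enat (hitting_time y \<omega>)"
    proof (cases "\<omega> \<in> H")
      case False
      then have "enat n \<le> hitting_time y \<omega>"
        by (intro hitting_time_ge) (auto simp: H_def)
      then have "ennreal_of_enat (enat n) \<le> ennreal_of_enat (hitting_time y \<omega>)"
        by (simp only: ennreal_of_enat_le_iff)
      with False show ?thesis
        by (simp add: ennreal_of_enat_def[of "enat n"])
    qed simp
  qed
  finally show ?thesis .
qed

text \<open>The invariant set \<open>S\<close> will be the permutations: the state type contains all
  functions, but the drift estimate is available only there.\<close>

lemma nn_integral_chain_drift:
  fixes \<Phi> :: "'a \<Rightarrow> ennreal"
  assumes "x\<^sub>0 \<in> S" and "\<And>x y. x \<in> S \<Longrightarrow> y \<in> set_pmf (K x) \<Longrightarrow> y \<in> S"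
    and "\<And>x. x \<in> S \<Longrightarrow> (\<integral>\<^sup>+y. \<Phi> y \<partial>measure_pmf (K x)) \<le> c * \<Phi> x"
  shows "(\<integral>\<^sup>+y. \<Phi> y \<partial>measure_pmf (chain_pmf K x\<^sub>0 t)) \<le> c ^ t * \<Phi> x\<^sub>0"
proof -
  have S: "set_pmf (chain_pmf K x\<^sub>0 t) \<subseteq> S" for t
    using assms(1,2) by (induction t) auto
  show ?thesis
  proof (induction t)
    case (Suc t)
    have "(\<integral>\<^sup>+y. \<Phi> y \<partial>measure_pmf (chain_pmf K x\<^sub>0 (Suc t))) =
        (\<integral>\<^sup>+x. \<integral>\<^sup>+y. \<Phi> y \<partial>measure_pmf (K x) \<partial>measure_pmf (chain_pmf K x\<^sub>0 t))"
      by (simp add: nn_integral_bind_pmf)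
    also have "\<dots> \<le> (\<integral>\<^sup>+x. c * \<Phi> x \<partial>measure_pmf (chain_pmf K x\<^sub>0 t))"
      using S by (intro nn_integral_mono_AE) (auto simp: AE_measure_pmf_iff intro!: assms(3))
    also have "\<dots> = c * (\<integral>\<^sup>+x. \<Phi> x \<partial>measure_pmf (chain_pmf K x\<^sub>0 t))"
      by (rule nn_integral_cmult) simp
    also have "\<dots> \<le> c * (c ^ t * \<Phi> x\<^sub>0)"
      by (intro mult_left_mono Suc.IH) simp
    finally show ?case
      by (simp add: mult.assoc)
  qed simp
qed

section \<open>Meets in the weak order\<close>

declare One_nat_def [simp del]

text \<open>Inversions are pairs of values, not of positions: right multiplication moves positions,
  so value pairs are what can be compared along the right weak order.\<close>

definition inversions :: "(nat \<Rightarrow> nat) \<Rightarrow> (nat \<times> nat) set" where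
  "inversions w = {(a, b). a < b \<and> inv w b < inv w a}"

text \<open>An element \<open>l\<close> of \<open>T\<close> stands for the gap between the positions
  \<open>l\<close> and \<open>l + 1\<close>. Two positions swap their order exactly if
  \<open>T\<close> contains all gaps between them, that is, if they share a block.\<close>

definition block_reversal :: "nat \<Rightarrow> nat set \<Rightarrow> (nat \<Rightarrow> nat) \<Rightarrow> bool" where
  "block_reversal n T \<beta> \<longleftrightarrow> \<beta> permutes {1..n} \<and> (\<forall>i. \<beta> (\<beta> i) = i) \<and>
     (\<forall>i j. i < j \<longrightarrow> (\<beta> j < \<beta> i \<longleftrightarrow> {i..<j} \<subseteq> T))"

lemma inversions_iff:
  assumes "w permutes A"
  shows "(w j, w i) \<in> inversions w \<longleftrightarrow> w j < w i \<and> i < j"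
  using assms by (simp add: inversions_def permutes_inverses)

lemma inversions_subset:
  assumes "w permutes {1..n}"
  shows "inversions w \<subseteq> {1..n} \<times> {1..n}"
proof clarify
  fix a b
  assume "(a, b) \<in> inversions w"
  then have ab: "a < b" "inv w b < inv w a"
    by (auto simp: inversions_def)
  have w: "inv w permutes {1..n}"
    using assms by (rule permutes_inv)
  have in_iff: "inv w c \<in> {1..n} \<longleftrightarrow> c \<in> {1..n}" for c
    using w by (rule permutes_in_image)
  have out: "inv w c = c" if "c \<notin> {1..n}" for c
    using w that by (rule permutes_not_in)
  have "b \<le> n"
  proof (rule ccontr)
    assume "\<not> b \<le> n"
    then have "inv w b = b"
      by (intro out) auto
    moreover have "inv w a < b"
      using ab(1) \<open>\<not> b \<le> n\<close> in_iff[of a] out[of a] by (cases "a \<in> {1..n}") auto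
    ultimately show False
      using ab(2) by simp
  qed
  moreover have "1 \<le> a"
  proof (rule ccontr)
    assume "\<not> 1 \<le> a"
    then have "inv w a = 0"
      using out[of a] by auto
    then show False
      using ab(2) by simp
  qed
  ultimately show "a \<in> {1..n} \<and> b \<in> {1..n}"
    using ab(1) by simp
qed

lemma permutes_strict_mono_imp_id:
  assumes "f permutes {1..n}" and "\<And>i. i \<in> {1..<n} \<Longrightarrow> f i < f (Suc i)"
  shows "f = id"
proof (rule permutes_natset_ge[OF assms(1)])
  have "i \<le> n \<Longrightarrow> i \<le> f i" for i
  proof (induction i)
    case (Suc i)
    show ?case
    proof (cases "i = 0")
      case True
      then have "f 1 \<in> {1..n}"
        using Suc.prems by (subst permutes_in_image[OF assms(1)]) auto
      then show ?thesis
        using True by (simp add: One_nat_def)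
    next
      case False
      then show ?thesis
        using Suc assms(2)[of i] by simp
    qed
  qed simp
  then show "\<forall>i\<in>{1..n}. i \<le> f i"
    by simp
qed

text \<open>Otherwise \<open>inv w \<circ> w'\<close> would be increasing: at descents of
  \<open>w'\<close> because the pair is inverted in \<open>w\<close>, at ascents because
  \<open>w\<close> has no inversion that \<open>w'\<close> lacks. An increasing permutation is the
  identity.\<close>

lemma exists_descent_not_inversion:
  assumes w: "w permutes {1..n}" and w': "w' permutes {1..n}"
    and sub: "inversions w \<subseteq> inversions w'" and neq: "w \<noteq> w'"
  shows "\<exists>i\<in>descents n w'. (w' (Suc i), w' i) \<notin> inversions w"
proof (rule ccontr)
  assume *: "\<not> ?thesis"
  have "inv w \<circ> w' = id"
  proof (rule permutes_strict_mono_imp_id)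
    show "inv w \<circ> w' permutes {1..n}"
      using w w' by (intro permutes_compose permutes_inv)
    fix i
    assume i: "i \<in> {1..<n}"
    show "(inv w \<circ> w') i < (inv w \<circ> w') (Suc i)"
    proof (cases "w' (Suc i) < w' i")
      case True
      then have "(w' (Suc i), w' i) \<in> inversions w"
        using * i by (auto simp: descents_def)
      then show ?thesis
        by (simp add: inversions_def)
    next
      case False
      have "w' i \<noteq> w' (Suc i)" "inv w (w' i) \<noteq> inv w (w' (Suc i))"
        using permutes_inj[OF w'] permutes_inj[OF permutes_inv[OF w]] by (simp_all add: inj_eq)
      with False have "w' i < w' (Suc i)"
        by simp
      moreover have "(w' i, w' (Suc i)) \<notin> inversions w"
        using sub inversions_iff[OF w'] by auto
      ultimately show ?thesis
        using \<open>inv w (w' i) \<noteq> inv w (w' (Suc i))\<close> by (simp add: inversions_def)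
    qed
  qed
  then have "w \<circ> (inv w \<circ> w') = w"
    by simp
  then have "w' = w"
    using permutes_surj[OF w] by (metis comp_assoc fun.map_id surj_iff id_comp)
  with neq show False
    by simp
qed

lemma transpose_Suc_less_iff:
  assumes "p \<noteq> q"
  shows "Transposition.transpose i (Suc i) p < Transposition.transpose i (Suc i) q \<longleftrightarrow>
    (if {p, q} = {i, Suc i} then q < p else p < q)"
  using assms by (auto simp: Transposition.transpose_def doubleton_eq_iff)

lemma inversions_transpose:
  assumes w: "w permutes {1..n}" and i: "i \<in> descents n w"
  shows "inversions (w \<circ> Transposition.transpose i (Suc i)) = inversions w - {(w (Suc i), w i)}"
proof -
  let ?s = "Transposition.transpose i (Suc i)"
  have [simp]: "inv w a = inv w b \<longleftrightarrow> a = b" for a b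
    using permutes_inj[OF permutes_inv[OF w]] by (simp add: inj_eq)
  have pos: "inv w a = j \<longleftrightarrow> a = w j" for a j
    using w by (auto simp: permutes_inverses)
  have "inv (w \<circ> ?s) = ?s \<circ> inv w"
    using w by (subst o_inv_distrib) (auto simp: permutes_bij)
  moreover have "w (Suc i) < w i"
    using i by (simp add: descents_def)
  moreover have "w i \<noteq> w (Suc i)"
    using calculation by simp
  ultimately show ?thesis
    by (auto simp: inversions_def transpose_Suc_less_iff doubleton_eq_iff pos permutes_inverses[OF w]
        split: if_splits)
qed

lemma weak_cover_transpose:
  "i \<in> descents n w \<Longrightarrow> weak_cover n (w \<circ> Transposition.transpose i (Suc i)) w"
  unfolding weak_cover_def
  by (rule bexI[of _ i]) (auto simp: fun_eq_iff descents_def)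

lemma weak_coverE:
  assumes "weak_cover n w w'"
  obtains i where "i \<in> descents n w'" "w = w' \<circ> Transposition.transpose i (Suc i)"
  using assms unfolding weak_cover_def by (auto simp: comp_assoc)

lemma permutes_transpose_descent:
  assumes "w permutes {1..n}" "i \<in> descents n w"
  shows "w \<circ> Transposition.transpose i (Suc i) permutes {1..n}"
  using assms by (intro permutes_compose permutes_swap_id) (auto simp: descents_def)

text \<open>For the converse, swap a descent of \<open>w'\<close> whose pair is not inverted in
  \<open>w\<close>. This removes one inversion, stays above \<open>w\<close>, and the induction
  continues.\<close>

lemma weak_order_le_iff:
  assumes w: "w permutes {1..n}" and w': "w' permutes {1..n}"
  shows "(weak_cover n)\<^sup>*\<^sup>* w w' \<longleftrightarrow> inversions w \<subseteq> inversions w'"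
proof
  assume "(weak_cover n)\<^sup>*\<^sup>* w w'"
  then have "w' permutes {1..n} \<longrightarrow> w permutes {1..n} \<and> inversions w \<subseteq> inversions w'"
  proof (induction rule: converse_rtranclp_induct)
    case (step y z)
    then obtain i where "i \<in> descents n z" "y = z \<circ> Transposition.transpose i (Suc i)"
      by (elim weak_coverE)
    with step.IH show ?case
      using permutes_transpose_descent inversions_transpose by blast
  qed simp
  with w' show "inversions w \<subseteq> inversions w'"
    by simp
next
  show "inversions w \<subseteq> inversions w' \<Longrightarrow> (weak_cover n)\<^sup>*\<^sup>* w w'"
    using w'
  proof (induction "card (inversions w')" arbitrary: w' rule: less_induct)
    case less
    show ?case
    proof (cases "w = w'")
      case False
      then obtain i where i: "i \<in> descents n w'" "(w' (Suc i), w' i) \<notin> inversions w"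
        using exists_descent_not_inversion w less.prems by blast
      let ?z = "w' \<circ> Transposition.transpose i (Suc i)"
      have inv: "inversions ?z = inversions w' - {(w' (Suc i), w' i)}"
        by (rule inversions_transpose) fact+
      have "(w' (Suc i), w' i) \<in> inversions w'"
        using i(1) by (simp add: inversions_iff[OF less.prems(2)] descents_def)
      moreover have "finite (inversions w')"
        using inversions_subset[OF less.prems(2)] finite_subset by blast
      ultimately have "card (inversions ?z) < card (inversions w')"
        unfolding inv by (intro psubset_card_mono) auto
      moreover have "inversions w \<subseteq> inversions ?z"
        using less.prems(1) i(2) inv by blast
      ultimately have "(weak_cover n)\<^sup>*\<^sup>* w ?z"
        using less.hyps[of ?z] permutes_transpose_descent[OF less.prems(2) i(1)] by simp
      then show ?thesis
        using weak_cover_transpose[OF i(1)] by (meson rtranclp.rtrancl_into_rtrancl)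
    qed simp
  qed
qed

lemma weak_order_simps [simp]:
  "carrier (weak_order n) = {w. w permutes {1..n}}"
  "w \<sqsubseteq>\<^bsub>weak_order n\<^esub> w' \<longleftrightarrow> (weak_cover n)\<^sup>*\<^sup>* w w'"
  "w .=\<^bsub>weak_order n\<^esub> w' \<longleftrightarrow> w = w'"
  by (auto simp: weak_order_def)

lemma weak_order_antisym:
  assumes "w permutes {1..n}" "w' permutes {1..n}" "inversions w = inversions w'"
  shows "w = w'"
proof (rule ccontr)
  assume "w \<noteq> w'"
  then obtain i where "i \<in> descents n w'" "(w' (Suc i), w' i) \<notin> inversions w"
    using exists_descent_not_inversion assms by blast
  then show False
    using assms by (simp add: inversions_iff descents_def)
qed

text \<open>Meets and the top element are Hilbert choices of a greatest element, so computing them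
  requires uniqueness.\<close>

lemma greatest_weak_order_unique:
  assumes "greatest (weak_order n) x A" "greatest (weak_order n) y A"
  shows "x = y"
proof -
  have c: "x permutes {1..n}" "y permutes {1..n}"
    using assms by (auto simp: greatest_def)
  have "inversions x = inversions y"
    using assms weak_order_le_iff[OF c] weak_order_le_iff[OF c(2,1)] by (auto simp: greatest_def)
  with c show ?thesis
    by (rule weak_order_antisym)
qed

text \<open>If \<open>y\<close> lies below \<open>x\<close>, some descent pair of \<open>x\<close>
  is not inverted in \<open>y\<close>, so \<open>y\<close> lies below the corresponding swap and,
  being covered, equals it. Conversely a swap misses a single inversion, which leaves no room in
  between.\<close>

lemma covered_set_weak_order:
  assumes x: "x permutes {1..n}"
  shows "covered_set (weak_order n) x = (\<lambda>i. x \<circ> Transposition.transpose i (Suc i)) ` descents n x"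
    (is "_ = ?s ` _")
proof (intro equalityI subsetI)
  fix y
  assume y: "y \<in> covered_set (weak_order n) x"
  then have yp: "y permutes {1..n}" and "y \<noteq> x" and le: "inversions y \<subseteq> inversions x"
    using x by (auto simp: covered_set_def lless_def weak_order_le_iff)
  then obtain i where i: "i \<in> descents n x" "(x (Suc i), x i) \<notin> inversions y"
    using exists_descent_not_inversion[OF yp x] by blast
  have z: "?s i permutes {1..n}"
    by (rule permutes_transpose_descent[OF x i(1)])
  have inv: "inversions (?s i) = inversions x - {(x (Suc i), x i)}"
    by (rule inversions_transpose[OF x i(1)])
  have "(x (Suc i), x i) \<in> inversions x"
    using i(1) by (simp add: inversions_iff[OF x] descents_def)
  then have "?s i \<noteq> x"
    using inv by (metis Diff_iff singletonI)
  then have "\<not> (inversions y \<subseteq> inversions (?s i) \<and> y \<noteq> ?s i)"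
    using y z yp x inv unfolding covered_set_def lless_def
    by (auto simp: weak_order_le_iff simp del: o_apply)
  then have "y = ?s i"
    using le i(2) inv by blast
  with i show "y \<in> ?s ` descents n x"
    by blast
next
  fix y
  assume "y \<in> ?s ` descents n x"
  then obtain i where i: "i \<in> descents n x" and y: "y = ?s i"
    by blast
  have yp: "y permutes {1..n}"
    unfolding y by (rule permutes_transpose_descent[OF x i(1)])
  have inv: "inversions y = inversions x - {(x (Suc i), x i)}"
    unfolding y by (rule inversions_transpose[OF x i(1)])
  have "(x (Suc i), x i) \<in> inversions x"
    using i(1) by (simp add: inversions_iff[OF x] descents_def)
  then have "y \<noteq> x"
    using inv by blast
  moreover have False if "z permutes {1..n}" "inversions y \<subseteq> inversions z" "z \<noteq> y" "inversions z \<subseteq> inversions x" "z \<noteq> x" for z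
  proof -
    have "inversions z = inversions x \<or> inversions z = inversions y"
      using that inv by blast
    then show False
      using weak_order_antisym that x yp by blast
  qed
  moreover have "y \<in> covered_set (weak_order n) x \<longleftrightarrow> inversions y \<subseteq> inversions x \<and> y \<noteq> x \<and>
      \<not> (\<exists>z. z permutes {1..n} \<and> inversions y \<subseteq> inversions z \<and> y \<noteq> z \<and> inversions z \<subseteq> inversions x \<and> z \<noteq> x)"
    using x yp by (auto simp: covered_set_def lless_def weak_order_le_iff) blast
  ultimately show "y \<in> covered_set (weak_order n) x"
    using inv by blast
qed

lemma inj_transpose_Suc:
  assumes "inj x"
  shows "inj_on (\<lambda>i. x \<circ> Transposition.transpose i (Suc i)) D"
proof (rule inj_onI)
  fix i j
  assume "x \<circ> Transposition.transpose i (Suc i) = x \<circ> Transposition.transpose j (Suc j)"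
  then have "Transposition.transpose i (Suc i) = Transposition.transpose j (Suc j)"
    using assms by (simp add: fun.inj_map_strong fun_eq_iff inj_eq)
  then have "Transposition.transpose i (Suc i) i = Transposition.transpose j (Suc j) i"
    "Transposition.transpose i (Suc i) j = Transposition.transpose j (Suc j) j"
    by auto
  then show "i = j"
    by (auto simp: Transposition.transpose_def split: if_splits)
qed

section \<open>Meets of covered elements as block reversals\<close>

lemma inversions_block_reversal:
  assumes x: "x permutes {1..n}" and \<beta>: "block_reversal n T \<beta>"
  shows "inversions (x \<circ> \<beta>) = {(a, b). a < b \<and> \<beta> (inv x b) < \<beta> (inv x a)}"
proof -
  have "inv (x \<circ> \<beta>) = inv \<beta> \<circ> inv x"
    using x \<beta> by (subst o_inv_distrib) (auto simp: permutes_bij block_reversal_def)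
  also have "inv \<beta> = \<beta>"
    using \<beta> by (intro inv_equality) (auto simp: block_reversal_def)
  finally have "inv (x \<circ> \<beta>) = \<beta> \<circ> inv x" .
  then show ?thesis
    unfolding inversions_def by (simp only: o_apply)
qed

lemma Lower_weak_order:
  assumes "A \<subseteq> {w. w permutes {1..n}}"
  shows "Lower (weak_order n) A = {z. z permutes {1..n} \<and> (\<forall>y\<in>A. inversions z \<subseteq> inversions y)}"
  using assms unfolding Lower_def by (auto simp: weak_order_le_iff subset_eq)

text \<open>The lower bounds are the permutations below \<open>x\<close> in which no pair across a
  gap of \<open>T\<close> is inverted, hence by transitivity no pair inside a block. Block reversal
  removes exactly the inversions of \<open>x\<close> inside blocks, so it is the largest of
  them.\<close>

lemma greatest_block_reversal:
  assumes x: "x permutes {1..n}" and T: "T \<subseteq> descents n x" and \<beta>: "block_reversal n T \<beta>"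
  shows "greatest (weak_order n) (x \<circ> \<beta>)
    (Lower (weak_order n) ({x} \<union> (\<lambda>i. x \<circ> Transposition.transpose i (Suc i)) ` T))"
    (is "greatest ?L _ (Lower ?L ?A)")
proof -
  let ?s = "\<lambda>i. x \<circ> Transposition.transpose i (Suc i)"
  have \<beta>_less: "i < j \<Longrightarrow> \<beta> j < \<beta> i \<longleftrightarrow> {i..<j} \<subseteq> T" for i j
    using \<beta> by (simp add: block_reversal_def)
  have x\<beta>: "x \<circ> \<beta> permutes {1..n}"
    using x \<beta> by (intro permutes_compose) (auto simp: block_reversal_def)
  have s: "?s i permutes {1..n}" "inversions (?s i) = inversions x - {(x (Suc i), x i)}" if "i \<in> T" for i
    using that T x by (auto intro!: permutes_transpose_descent inversions_transpose simp del: o_apply)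
  have pos: "inv x (x i) = i" "x (inv x i) = i" for i
    using x by (auto simp: permutes_inverses)
  have dec: "x j < x i" if "{i..<j} \<subseteq> T" "i < j" for i j
    using that(2,1)
  proof (induction i j rule: less_Suc_induct)
    case (1 i)
    then show ?case
      using T by (auto simp: descents_def)
  next
    case (2 i j k)
    then have "{i..<j} \<subseteq> T" "{j..<k} \<subseteq> T"
      by auto
    with 2 show ?case
      by simp
  qed
  have Low: "z \<in> Lower ?L ?A \<longleftrightarrow> z permutes {1..n} \<and> inversions z \<subseteq> inversions x \<and>
      (\<forall>i\<in>T. (x (Suc i), x i) \<notin> inversions z)" for z
  proof -
    have "?A \<subseteq> {w. w permutes {1..n}}"
      using x s(1) by blast
    then have "z \<in> Lower ?L ?A \<longleftrightarrow> z permutes {1..n} \<and> inversions z \<subseteq> inversions x \<and>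
      (\<forall>i\<in>T. inversions z \<subseteq> inversions (?s i))"
      unfolding Lower_weak_order[OF \<open>?A \<subseteq> {w. w permutes {1..n}}\<close>] by blast
    then show ?thesis
      using s(2) by (auto simp del: o_apply)
  qed
  have "inversions (x \<circ> \<beta>) \<subseteq> inversions x"
  proof clarify
    fix a b
    assume "(a, b) \<in> inversions (x \<circ> \<beta>)"
    then have ab: "a < b" "\<beta> (inv x b) < \<beta> (inv x a)"
      unfolding inversions_block_reversal[OF x \<beta>] by auto
    then have "inv x a \<noteq> inv x b"
      by auto
    moreover have "\<not> inv x a < inv x b"
      using ab \<beta>_less[of "inv x a" "inv x b"] dec[of "inv x a" "inv x b"] pos by auto
    ultimately show "(a, b) \<in> inversions x"
      using ab by (simp add: inversions_def)
  qed
  moreover have "(x (Suc i), x i) \<notin> inversions (x \<circ> \<beta>)" if "i \<in> T" for i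
    using that \<beta>_less[of i "Suc i"] unfolding inversions_block_reversal[OF x \<beta>] by (simp add: pos)
  ultimately have "x \<circ> \<beta> \<in> Lower ?L ?A"
    using x\<beta> by (simp only: Low) blast
  moreover have "inversions z \<subseteq> inversions (x \<circ> \<beta>)" if "z \<in> Lower ?L ?A" for z
  proof clarify
    from that have z: "z permutes {1..n}" "inversions z \<subseteq> inversions x"
      and zT: "\<And>i. i \<in> T \<Longrightarrow> (x (Suc i), x i) \<notin> inversions z"
      unfolding Low by blast+
    fix a b
    assume ab: "(a, b) \<in> inversions z"
    then have "(a, b) \<in> inversions x"
      using z by blast
    then have less: "a < b" "inv x b < inv x a"
      by (auto simp: inversions_def)
    have "\<not> {inv x b..<inv x a} \<subseteq> T"
    proof
      assume sub: "{inv x b..<inv x a} \<subseteq> T"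
      have "inv z (x q) < inv z (x p)" if "p < q" "{p..<q} \<subseteq> T" for p q
        using that
      proof (induction p q rule: less_Suc_induct)
        case (1 i)
        then have "(x (Suc i), x i) \<notin> inversions z" "x (Suc i) < x i"
          using zT T by (auto simp: descents_def)
        moreover have "inv z (x (Suc i)) \<noteq> inv z (x i)"
          using calculation(2) permutes_inj[OF permutes_inv[OF z(1)]] by (simp add: inj_eq)
        ultimately show ?case
          by (simp add: inversions_def)
      next
        case (2 i j k)
        then have "{i..<j} \<subseteq> T" "{j..<k} \<subseteq> T"
          by auto
        with 2 show ?case
          by simp
      qed
      from this[OF less(2) sub] ab show False
        by (simp add: inversions_def pos)
    qed
    then have "\<not> \<beta> (inv x a) < \<beta> (inv x b)"
      using \<beta>_less[OF less(2)] by simp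
    moreover have "\<beta> (inv x a) \<noteq> \<beta> (inv x b)"
      using less(2) \<beta> unfolding block_reversal_def by (metis less_irrefl)
    ultimately show "(a, b) \<in> inversions (x \<circ> \<beta>)"
      using less(1) unfolding inversions_block_reversal[OF x \<beta>] by simp
  qed
  ultimately show ?thesis
    unfolding greatest_def using weak_order_le_iff[OF _ x\<beta>] Low Lower_closed[of ?L ?A] by simp
qed

lemma block_reversal_le:
  assumes x: "x permutes {1..n}" and T: "T \<subseteq> descents n x" and \<beta>: "block_reversal n T \<beta>"
  shows "(weak_cover n)\<^sup>*\<^sup>* (x \<circ> \<beta>) x"
    and "l \<in> T \<Longrightarrow> (weak_cover n)\<^sup>*\<^sup>* (x \<circ> \<beta>) (x \<circ> Transposition.transpose l (Suc l))"
proof -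
  let ?A = "{x} \<union> (\<lambda>i. x \<circ> Transposition.transpose i (Suc i)) ` T"
  have A: "?A \<subseteq> {w. w permutes {1..n}}"
    using x T permutes_transpose_descent by blast
  have "x \<circ> \<beta> \<in> Lower (weak_order n) ?A"
    using greatest_block_reversal[OF assms] by (rule greatest_mem)
  then have *: "(weak_cover n)\<^sup>*\<^sup>* (x \<circ> \<beta>) y" if "y \<in> ?A" for y
    using that A unfolding Lower_def by auto
  show "(weak_cover n)\<^sup>*\<^sup>* (x \<circ> \<beta>) x"
    by (rule *) simp
  show "(weak_cover n)\<^sup>*\<^sup>* (x \<circ> \<beta>) (x \<circ> Transposition.transpose l (Suc l))" if "l \<in> T"
    using that by (intro *) blast
qed

lemma meet_block_reversal:
  assumes x: "x permutes {1..n}" and T: "T \<subseteq> descents n x" and \<beta>: "block_reversal n T \<beta>"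
  shows "\<Sqinter>\<^bsub>weak_order n\<^esub> ({x} \<union> (\<lambda>i. x \<circ> Transposition.transpose i (Suc i)) ` T) = x \<circ> \<beta>"
  unfolding Lattice.inf_def
  using greatest_block_reversal[OF assms] greatest_weak_order_unique by blast

text \<open>The witness reflects \<open>i\<close> in the maximal block from \<open>lo i\<close> to
  \<open>hi i\<close> around it. By \<open>same\<close> all members of a block have the same
  endpoints, which makes this an involution.\<close>

lemma block_reversal_exists:
  assumes T: "T \<subseteq> {1..<n}"
  shows "\<exists>\<beta>. block_reversal n T \<beta>"
proof -
  define lo where "lo i = (LEAST l. {l..<i} \<subseteq> T)" for i
  define hi where "hi i = (GREATEST h. {i..<h} \<subseteq> T)" for i
  define \<beta> where "\<beta> i = lo i + hi i - i" for i
  have lo: "{lo i..<i} \<subseteq> T" "lo i \<le> i" and lo_le: "{l..<i} \<subseteq> T \<Longrightarrow> lo i \<le> l" for i l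
    unfolding lo_def using LeastI[of "\<lambda>l. {l..<i} \<subseteq> T" i] by (auto intro: Least_le)
  \<comment> \<open>\<open>GREATEST\<close> needs a bound on its candidates. Every \<open>h\<close>
    up to \<open>i\<close> is one, as the interval is then empty, so \<open>n\<close> alone would
    not do.\<close>
  have bound: "h \<le> i + n" if "{i..<h} \<subseteq> T" for i h
  proof (cases "i < h")
    case True
    then have "h - 1 \<in> {i..<h}"
      by auto
    then have "h - 1 \<in> {1..<n}"
      using that T by blast
    then show ?thesis
      by auto
  qed auto
  have hi: "{i..<hi i} \<subseteq> T" for i
    unfolding hi_def by (rule GreatestI_nat[where k = i and b = "i + n"]) (use bound in auto)
  have le_hi: "{i..<h} \<subseteq> T \<Longrightarrow> h \<le> hi i" for i h
    unfolding hi_def by (rule Greatest_le_nat[where b = "i + n"]) (use bound in auto)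
  have hi_ge: "i \<le> hi i" for i
    by (rule le_hi) simp
  have block: "{lo i..<hi i} \<subseteq> T" for i
  proof -
    have "{lo i..<hi i} \<subseteq> {lo i..<i} \<union> {i..<hi i}"
      by auto
    then show ?thesis
      using lo(1)[of i] hi[of i] by blast
  qed
  have same: "lo j = lo i \<and> hi j = hi i" if "lo i \<le> j" "j \<le> hi i" for i j
  proof -
    have "lo j \<le> lo i" "hi i \<le> hi j"
      using block[of i] that by (auto intro!: lo_le le_hi)
    moreover from this have "{lo j..<i} \<subseteq> {lo j..<hi j}" "{i..<hi j} \<subseteq> {lo j..<hi j}"
      using lo(2)[of i] hi_ge[of i] by auto
    then have "lo i \<le> lo j" "hi j \<le> hi i"
      using block[of j] by (auto intro!: lo_le le_hi)
    ultimately show ?thesis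
      by simp
  qed
  have in_block: "lo i \<le> \<beta> i" "\<beta> i \<le> hi i" for i
    using lo(2)[of i] hi_ge[of i] by (auto simp: \<beta>_def)
  have \<beta>\<beta>: "\<beta> (\<beta> i) = i" for i
  proof -
    have "\<beta> (\<beta> i) = lo i + hi i - \<beta> i"
      using same[OF in_block, of i] by (simp add: \<beta>_def[of "\<beta> i"])
    also have "\<dots> = i"
      using lo(2)[of i] hi_ge[of i] by (simp add: \<beta>_def)
    finally show ?thesis .
  qed
  have \<beta>_less: "\<beta> j < \<beta> i \<longleftrightarrow> {i..<j} \<subseteq> T" if "i < j" for i j
  proof
    assume "{i..<j} \<subseteq> T"
    then have "j \<le> hi i"
      by (rule le_hi)
    moreover have "lo i \<le> j"
      using lo(2)[of i] that by simp
    ultimately have "lo j = lo i \<and> hi j = hi i"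
      by (intro same)
    with \<open>j \<le> hi i\<close> that show "\<beta> j < \<beta> i"
      by (simp add: \<beta>_def)
  next
    assume less: "\<beta> j < \<beta> i"
    show "{i..<j} \<subseteq> T"
    proof (cases "lo j \<le> hi i")
      case True
      then have "{i..<j} \<subseteq> {i..<hi i} \<union> {lo j..<j}"
        by auto
      then show ?thesis
        using hi[of i] lo(1)[of j] by blast
    next
      case False
      then show ?thesis
        using in_block(2)[of i] in_block(1)[of j] less by simp
    qed
  qed
  have "\<beta> i = i" if "i \<notin> {1..n}" for i
  proof -
    have "lo i = i"
    proof (rule ccontr)
      assume "lo i \<noteq> i"
      then have "i - 1 \<in> T"
        using lo[of i] by auto
      then show False
        using T that by (auto dest!: subsetD)
    qed
    moreover have "hi i = i"
    proof (rule ccontr)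
      assume "hi i \<noteq> i"
      then have "i \<in> T"
        using hi[of i] hi_ge[of i] by auto
      then show False
        using T that by auto
    qed
    ultimately show ?thesis
      by (simp add: \<beta>_def)
  qed
  then have "\<beta> permutes {1..n}"
    unfolding permutes_def using \<beta>\<beta> by metis
  then have "block_reversal n T \<beta>"
    using \<beta>\<beta> \<beta>_less by (auto simp: block_reversal_def)
  then show ?thesis
    by blast
qed

section \<open>Top and bottom of the weak order\<close>

definition reverse_perm :: "nat \<Rightarrow> nat \<Rightarrow> nat" where
  "reverse_perm n i = (if i \<in> {1..n} then n + 1 - i else i)"

lemma reverse_perm_invol: "reverse_perm n (reverse_perm n i) = i"
  by (auto simp: reverse_perm_def)

lemma reverse_perm_permutes: "reverse_perm n permutes {1..n}"
  unfolding permutes_def by (metis reverse_perm_def reverse_perm_invol)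

lemma inv_reverse_perm: "inv (reverse_perm n) = reverse_perm n"
  by (intro inv_equality) (auto simp: reverse_perm_def)

lemma top_weak_order: "\<top>\<^bsub>weak_order n\<^esub> = reverse_perm n"
proof -
  have "inversions w \<subseteq> inversions (reverse_perm n)" if "w permutes {1..n}" for w
    using inversions_subset[OF that]
    by (auto simp: inversions_def inv_reverse_perm reverse_perm_def)
  then have "greatest (weak_order n) (reverse_perm n) (carrier (weak_order n))"
    by (auto simp: greatest_def reverse_perm_permutes weak_order_le_iff)
  then show ?thesis
    unfolding Order.top_def using greatest_weak_order_unique by blast
qed

lemma bottom_weak_order: "\<bottom>\<^bsub>weak_order n\<^esub> = id"
proof -
  have id: "id permutes {1..n}" "inversions id = {}"
    by (auto simp: permutes_id inversions_def)
  have "least (weak_order n) x (carrier (weak_order n)) \<longleftrightarrow> x = id" for x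
  proof
    assume "least (weak_order n) x (carrier (weak_order n))"
    then have "x permutes {1..n}" "inversions x \<subseteq> inversions id"
      using id weak_order_le_iff[of x n id] by (auto simp: least_def)
    then show "x = id"
      using id by (intro weak_order_antisym) auto
  next
    assume "x = id"
    then show "least (weak_order n) x (carrier (weak_order n))"
      using id by (auto simp: least_def weak_order_le_iff)
  qed
  then show ?thesis
    unfolding Order.bottom_def by simp
qed

section \<open>The potential function\<close>

text \<open>As \<open>l\<close> runs over the gaps, the pairs (\<open>left_large\<close>,
  \<open>right_small\<close>) trace the boundary path of the Young diagram of level
  \<open>k\<close>.\<close>

definition left_large :: "nat \<Rightarrow> nat \<Rightarrow> (nat \<Rightarrow> nat) \<Rightarrow> nat" where
  "left_large k l w = card {q \<in> {1..l}. k < w q}"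

definition right_small :: "nat \<Rightarrow> nat \<Rightarrow> nat \<Rightarrow> (nat \<Rightarrow> nat) \<Rightarrow> nat" where
  "right_small n k l w = card {q \<in> {Suc l..n}. w q \<le> k}"

lemma card_transpose_Collect:
  assumes "i \<in> A \<longleftrightarrow> Suc i \<in> A"
  shows "card {q \<in> A. P (Transposition.transpose i (Suc i) q)} = card {q \<in> A. P q}"
  using assms
  by (intro bij_betw_same_card[of "Transposition.transpose i (Suc i)"]
        bij_betw_byWitness[where f' = "Transposition.transpose i (Suc i)"])
     (auto simp: Transposition.transpose_def)

text \<open>Only the prefix that ends between the two swapped positions changes its set of entries,
  and it trades the larger entry for the smaller one.\<close>

lemma left_large_transpose_le:
  assumes "w (Suc i) < w i" "1 \<le> i"
  shows "left_large k l (w \<circ> Transposition.transpose i (Suc i)) \<le> left_large k l w"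
proof (cases "l = i")
  case True
  have "{q \<in> {1..l}. k < (w \<circ> Transposition.transpose i (Suc i)) q} \<subseteq> {q \<in> {1..l}. k < w q}"
    using assms True by (auto simp: Transposition.transpose_def split: if_splits)
  then show ?thesis
    unfolding left_large_def by (intro card_mono) auto
next
  case False
  then have "i \<in> {1..l} \<longleftrightarrow> Suc i \<in> {1..l}"
    using assms by auto
  from card_transpose_Collect[OF this, of "\<lambda>q. k < w q"] show ?thesis
    by (simp add: left_large_def)
qed

lemma right_small_transpose_le:
  assumes "w (Suc i) < w i" "i < n"
  shows "right_small n k l (w \<circ> Transposition.transpose i (Suc i)) \<le> right_small n k l w"
proof (cases "l = i")
  case True
  have "{q \<in> {Suc l..n}. (w \<circ> Transposition.transpose i (Suc i)) q \<le> k} \<subseteq> {q \<in> {Suc l..n}. w q \<le> k}"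
    using assms True by (auto simp: Transposition.transpose_def split: if_splits)
  then show ?thesis
    unfolding right_small_def by (intro card_mono) auto
next
  case False
  then have "i \<in> {Suc l..n} \<longleftrightarrow> Suc i \<in> {Suc l..n}"
    using assms by auto
  from card_transpose_Collect[OF this, of "\<lambda>q. w q \<le> k"] show ?thesis
    by (simp add: right_small_def)
qed

lemma left_large_transpose_less:
  assumes "w (Suc i) \<le> k" "k < w i" "1 \<le> i"
  shows "left_large k i (w \<circ> Transposition.transpose i (Suc i)) < left_large k i w"
proof -
  have "{q \<in> {1..i}. k < (w \<circ> Transposition.transpose i (Suc i)) q} \<subset> {q \<in> {1..i}. k < w q}"
    using assms by (auto simp: Transposition.transpose_def split: if_splits)
  then show ?thesis
    unfolding left_large_def by (intro psubset_card_mono) auto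
qed

lemma weak_order_counts_le:
  assumes "(weak_cover n)\<^sup>*\<^sup>* v w"
  shows "left_large k l v \<le> left_large k l w" "right_small n k l v \<le> right_small n k l w"
proof -
  have "left_large k l v \<le> left_large k l w \<and> right_small n k l v \<le> right_small n k l w"
    using assms
  proof (induction rule: rtranclp_induct)
    case (step y z)
    from step.hyps(2) obtain i where i: "i \<in> descents n z" "y = z \<circ> Transposition.transpose i (Suc i)"
      by (rule weak_coverE)
    then have "left_large k l y \<le> left_large k l z" "right_small n k l y \<le> right_small n k l z"
      unfolding i(2) by (auto intro!: left_large_transpose_le right_small_transpose_le
          simp: descents_def simp del: o_apply)
    with step.IH show ?case
      by simp
  qed simp
  then show "left_large k l v \<le> left_large k l w" "right_small n k l v \<le> right_small n k l w"
    by auto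
qed

lemma left_large_less:
  assumes "l < l'" "k < w l'"
  shows "left_large k l w < left_large k l' w"
proof -
  have "{q \<in> {1..l}. k < w q} \<subseteq> {q \<in> {1..l'}. k < w q}" "l' \<in> {q \<in> {1..l'}. k < w q}" "l' \<notin> {q \<in> {1..l}. k < w q}"
    using assms by auto
  then have "{q \<in> {1..l}. k < w q} \<subset> {q \<in> {1..l'}. k < w q}"
    by blast
  then show ?thesis
    unfolding left_large_def by (intro psubset_card_mono) auto
qed

lemma right_small_less:
  assumes "l < l'" "l' \<le> n" "w (Suc l) \<le> k"
  shows "right_small n k l' w < right_small n k l w"
proof -
  have "{q \<in> {Suc l'..n}. w q \<le> k} \<subseteq> {q \<in> {Suc l..n}. w q \<le> k}"
    "Suc l \<in> {q \<in> {Suc l..n}. w q \<le> k}" "Suc l \<notin> {q \<in> {Suc l'..n}. w q \<le> k}"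
    using assms by auto
  then have "{q \<in> {Suc l'..n}. w q \<le> k} \<subset> {q \<in> {Suc l..n}. w q \<le> k}"
    by blast
  then show ?thesis
    unfolding right_small_def by (intro psubset_card_mono) auto
qed

text \<open>
  Mark a position \<open>q\<close> by 1 if \<open>w q > k\<close> and by 0 otherwise.  A triple \<open>(k, i, j)\<close> is a cell if the
  \<open>i\<close>-th 1 from the left precedes the \<open>j\<close>-th 0 from the right; for fixed \<open>k\<close> these pairs form a Young
  diagram whose corners are the occurrences of 10, that is, the descents of \<open>w\<close> across level \<open>k\<close>.
\<close>

definition cells :: "nat \<Rightarrow> (nat \<Rightarrow> nat) \<Rightarrow> (nat \<times> nat \<times> nat) set" where
  "cells n w = {(k, i, j). k \<in> {1..<n} \<and> 1 \<le> i \<and> 1 \<le> j \<and>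
     (\<exists>l\<le>n. i \<le> left_large k l w \<and> j \<le> right_small n k l w)}"

definition corners :: "nat \<Rightarrow> (nat \<Rightarrow> nat) \<Rightarrow> (nat \<times> nat \<times> nat) set" where
  "corners n w = {(k, left_large k l w, right_small n k l w) |k l.
     l \<in> descents n w \<and> w (Suc l) \<le> k \<and> k < w l}"

lemma cells_subset: "cells n w \<subseteq> {1..n} \<times> {1..n} \<times> {1..n}"
proof -
  have "left_large k l w \<le> n" if "l \<le> n" for k l
  proof -
    have "left_large k l w \<le> card {1..l}"
      unfolding left_large_def by (intro card_mono) auto
    with that show ?thesis
      by simp
  qed
  moreover have "right_small n k l w \<le> n" for k l
  proof -
    have "right_small n k l w \<le> card {Suc l..n}"
      unfolding right_small_def by (intro card_mono) auto
    then show ?thesis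
      by simp
  qed
  ultimately show ?thesis
    unfolding cells_def by auto (meson order.trans)+
qed

lemma finite_cells: "finite (cells n w)"
  by (rule finite_subset[OF cells_subset]) auto

lemma corners_subset_cells:
  assumes "w permutes {1..n}"
  shows "corners n w \<subseteq> cells n w"
proof
  fix c
  assume "c \<in> corners n w"
  then obtain k l where c: "c = (k, left_large k l w, right_small n k l w)"
    and l: "l \<in> descents n w" "w (Suc l) \<le> k" "k < w l"
    by (auto simp: corners_def)
  from l have ln: "1 \<le> l" "l < n"
    by (auto simp: descents_def)
  have "w l \<in> {1..n}" "w (Suc l) \<in> {1..n}"
    using ln permutes_in_image[OF assms, of l] permutes_in_image[OF assms, of "Suc l"] by auto
  then have "k \<in> {1..<n}"
    using l by auto
  moreover have "1 \<le> left_large k l w"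
    using left_large_less[of 0 l k w] l ln by simp
  moreover have "1 \<le> right_small n k l w"
    using right_small_less[of l "Suc l" n w k] l ln by simp
  ultimately show "c \<in> cells n w"
    using ln unfolding c cells_def by (auto intro!: exI[of _ l])
qed

lemma cells_mono:
  assumes "(weak_cover n)\<^sup>*\<^sup>* v w"
  shows "cells n v \<subseteq> cells n w"
  using weak_order_counts_le[OF assms] unfolding cells_def by auto (meson order.trans)

text \<open>A gap witnessing the cell in \<open>v\<close> cannot exist: left of \<open>l\<close>
  there are too few large entries, right of \<open>l\<close> too few small ones, and at
  \<open>l\<close> itself the swap has lowered the number of large entries on the left.\<close>

lemma corner_notin_cells:
  assumes l: "l \<in> descents n w" "w (Suc l) \<le> k" "k < w l"
    and v: "(weak_cover n)\<^sup>*\<^sup>* v (w \<circ> Transposition.transpose l (Suc l))"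
  shows "(k, left_large k l w, right_small n k l w) \<notin> cells n v"
proof
  assume "(k, left_large k l w, right_small n k l w) \<in> cells n v"
  then obtain l' where l': "l' \<le> n" "left_large k l w \<le> left_large k l' v"
    "right_small n k l w \<le> right_small n k l' v"
    by (auto simp: cells_def)
  have vw: "(weak_cover n)\<^sup>*\<^sup>* v w"
    using v weak_cover_transpose[OF l(1)] by (meson rtranclp.rtrancl_into_rtrancl)
  note le = weak_order_counts_le[OF vw, of k l']
  consider "l' < l" | "l' = l" | "l < l'"
    by linarith
  then show False
  proof cases
    case 1
    then show ?thesis
      using left_large_less[of l' l k w] l l' le by simp
  next
    case 2
    then show ?thesis
      using weak_order_counts_le(1)[OF v, of k l] left_large_transpose_less[of w l k] l l'
      by (simp add: descents_def)
  next
    case 3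
    then show ?thesis
      using right_small_less[of l l' n w k] l l' le by simp
  qed
qed

text \<open>From a witnessing gap \<open>m\<close>, let \<open>p\<close> be the last position of a
  large entry up to \<open>m\<close> and \<open>r\<close> the first position of a small entry after
  \<open>p\<close>. Then \<open>r - 1\<close> is a descent across level \<open>k\<close>, and moving
  the gap there loses no large entry on the left and no small one on the right.\<close>

lemma cell_le_corner:
  assumes "(k, i, j) \<in> cells n w"
  shows "\<exists>i' j'. (k, i', j') \<in> corners n w \<and> i \<le> i' \<and> j \<le> j'"
proof -
  from assms obtain m where m: "m \<le> n" "1 \<le> i" "1 \<le> j" "i \<le> left_large k m w" "j \<le> right_small n k m w"
    by (auto simp: cells_def)
  let ?P = "{q \<in> {1..m}. k < w q}" and ?Q = "{q \<in> {Suc m..n}. w q \<le> k}"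
  have "?P \<noteq> {}" "?Q \<noteq> {}"
  proof -
    have "card ?P \<noteq> 0" "card ?Q \<noteq> 0"
      using m(2-) unfolding left_large_def right_small_def by linarith+
    then show "?P \<noteq> {}" "?Q \<noteq> {}"
      by (metis card.empty)+
  qed
  define p where "p = Max ?P"
  have p: "p \<in> ?P" and p_max: "\<And>q. q \<in> ?P \<Longrightarrow> q \<le> p"
    using Max_in[of ?P] \<open>?P \<noteq> {}\<close> unfolding p_def by auto
  define r where "r = (LEAST r. p < r \<and> w r \<le> k)"
  from \<open>?Q \<noteq> {}\<close> obtain q where q: "q \<in> ?Q"
    by blast
  with p have "p < q \<and> w q \<le> k"
    by auto
  then have "p < r \<and> w r \<le> k"
    unfolding r_def by (rule LeastI)
  then have r: "p < r" "w r \<le> k"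
    by auto
  have r_le: "r \<le> q'" if "p < q'" "w q' \<le> k" for q'
    unfolding r_def using that by (intro Least_le) simp
  have "k < w (r - 1)"
  proof (cases "p = r - 1")
    case True
    with p show ?thesis
      by simp
  next
    case False
    show ?thesis
    proof (rule ccontr)
      assume "\<not> k < w (r - 1)"
      then have "r \<le> r - 1"
        using r(1) False by (intro r_le) auto
      then show False
        using r(1) by simp
    qed
  qed
  moreover have "r \<le> n"
    using r_le[of q] q p by auto
  moreover have "Suc (r - 1) = r" "1 \<le> r - 1"
    using r(1) p by auto
  ultimately have "r - 1 \<in> descents n w" "w (Suc (r - 1)) \<le> k" "k < w (r - 1)"
    using r by (auto simp: descents_def)
  then have "(k, left_large k (r - 1) w, right_small n k (r - 1) w) \<in> corners n w"
    unfolding corners_def by blast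
  moreover have "left_large k m w \<le> left_large k (r - 1) w"
    unfolding left_large_def
  proof (intro card_mono subsetI)
    fix q
    assume "q \<in> ?P"
    then show "q \<in> {q \<in> {1..r - 1}. k < w q}"
      using p_max[of q] r(1) by auto
  qed simp
  moreover have "right_small n k m w \<le> right_small n k (r - 1) w"
    unfolding right_small_def using p r_le r(1) by (intro card_mono) auto
  ultimately show ?thesis
    using m by (meson order.trans)
qed

definition potential :: "nat \<Rightarrow> (nat \<Rightarrow> nat) \<Rightarrow> real" where
  "potential n w = (\<Sum>(k, i, j)\<in>cells n w. 2 ^ (i + j))"

lemma sum_power2_le: "(\<Sum>i\<in>{1..a}. 2 ^ i) \<le> (2 * 2 ^ a :: real)"
  by (induction a) (auto simp: One_nat_def)

lemma potential_le_corners: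
  assumes "w permutes {1..n}"
  shows "potential n w \<le> 4 * (\<Sum>(k, i, j)\<in>corners n w. 2 ^ (i + j))"
proof -
  let ?W = "\<lambda>(k :: nat, i, j). 2 ^ (i + j) :: real"
  obtain g :: "nat \<times> nat \<times> nat \<Rightarrow> nat \<times> nat \<times> nat" where g: "\<And>c. c \<in> cells n w \<Longrightarrow> g c \<in> corners n w \<and> fst (g c) = fst c \<and>
      fst (snd c) \<le> fst (snd (g c)) \<and> snd (snd c) \<le> snd (snd (g c))"
  proof -
    have "\<forall>c\<in>cells n w. \<exists>d :: nat \<times> nat \<times> nat. d \<in> corners n w \<and> fst d = fst c \<and>
      fst (snd c) \<le> fst (snd d) \<and> snd (snd c) \<le> snd (snd d)"
      using cell_le_corner by fastforce
    then show ?thesis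
      using that by metis
  qed
  have fin: "finite (corners n w)"
    using corners_subset_cells[OF assms] finite_cells finite_subset by blast
  have "potential n w = (\<Sum>d\<in>corners n w. \<Sum>c | c \<in> cells n w \<and> g c = d. ?W c)"
    unfolding potential_def using g fin by (intro sum.group[symmetric] finite_cells) auto
  also have "\<dots> \<le> (\<Sum>d\<in>corners n w. 4 * ?W d)"
  proof (intro sum_mono)
    fix d :: "nat \<times> nat \<times> nat"
    obtain k a b where d: "d = (k, a, b)"
      by (cases d) auto
    \<comment> \<open>The cells assigned to a corner lie in its rectangle; each of the two geometric
      series costs a factor 2, hence the 4.\<close>
    have "(\<Sum>c | c \<in> cells n w \<and> g c = d. ?W c) \<le> (\<Sum>c\<in>{k} \<times> {1..a} \<times> {1..b}. ?W c)"
    proof (intro sum_mono2)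
      show "{c. c \<in> cells n w \<and> g c = d} \<subseteq> {k} \<times> {1..a} \<times> {1..b}"
      proof
        fix c assume "c \<in> {c. c \<in> cells n w \<and> g c = d}"
        then show "c \<in> {k} \<times> {1..a} \<times> {1..b}"
          using g[of c] by (cases c) (auto simp: d cells_def)
      qed
    qed auto
    also have "\<dots> = (\<Sum>i\<in>{1..a}. 2 ^ i) * (\<Sum>j\<in>{1..b}. 2 ^ j)"
      by (simp add: sum.cartesian_product[symmetric] sum_product power_add)
    also have "\<dots> \<le> (2 * 2 ^ a) * (2 * 2 ^ b)"
      by (intro mult_mono sum_power2_le) (auto intro: sum_nonneg)
    also have "\<dots> = 4 * ?W d"
      by (simp add: d power_add)
    finally show "(\<Sum>c | c \<in> cells n w \<and> g c = d. ?W c) \<le> 4 * ?W d" .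
  qed
  finally show ?thesis
    by (simp add: sum_distrib_left)
qed

lemma potential_ge_1:
  assumes "w permutes {1..n}" "w \<noteq> id"
  shows "1 \<le> potential n w"
proof -
  have "\<exists>i\<in>descents n w. (w (Suc i), w i) \<notin> inversions id"
    using assms by (intro exists_descent_not_inversion) (auto simp: permutes_id inversions_def)
  then obtain l where l: "l \<in> descents n w"
    by blast
  \<comment> \<open>The smaller entry of a descent is itself a level that the descent
    crosses.\<close>
  then have "(w (Suc l), left_large (w (Suc l)) l w, right_small n (w (Suc l)) l w) \<in> corners n w"
    unfolding corners_def by (auto simp: descents_def)
  then obtain c where c: "c \<in> cells n w"
    using corners_subset_cells[OF assms(1)] by blast
  have "(1 :: real) \<le> (case c of (k, i, j) \<Rightarrow> 2 ^ (i + j))"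
    by (auto split: prod.split)
  also have "\<dots> \<le> potential n w"
    unfolding potential_def using c finite_cells by (intro member_le_sum) (auto split: prod.split)
  finally show ?thesis .
qed

text \<open>The 5 is 3 + 2: there are at most \<open>n ^ 3\<close> cells, bounded by
  \<open>exp (3 * n)\<close>, each of weight at most \<open>4 ^ n\<close>, bounded by
  \<open>exp (2 * n)\<close>.\<close>

lemma potential_le: "potential n w \<le> exp (5 * real n)"
proof -
  have "potential n w \<le> (\<Sum>c\<in>{1..n} \<times> {1..n} \<times> {1..n}. 2 ^ (n + n))"
    unfolding potential_def
  proof (rule order.trans[OF sum_mono])
    show "(case c of (k, i, j) \<Rightarrow> 2 ^ (i + j)) \<le> (2 ^ (n + n) :: real)" if "c \<in> cells n w" for c
      using that cells_subset[of n w]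
      by (auto split: prod.split intro!: power_increasing simp: subset_eq add_mono)
    show "(\<Sum>c\<in>cells n w. 2 ^ (n + n)) \<le> (\<Sum>c\<in>{1..n} \<times> {1..n} \<times> {1..n}. 2 ^ (n + n) :: real)"
      by (intro sum_mono2 cells_subset) auto
  qed
  also have "\<dots> = real n ^ 3 * 4 ^ n"
    by (simp add: card_cartesian_product power3_eq_cube power_add power_mult_distrib[symmetric])
  also have "\<dots> \<le> exp (real n) ^ 3 * exp 2 ^ n"
  proof (intro mult_mono power_mono)
    show "real n \<le> exp (real n)"
      using exp_ge_add_one_self[of "real n"] by linarith
    have "(2 :: real) \<le> exp 1"
      using exp_ge_add_one_self[of 1] by linarith
    then have "(2 :: real) * 2 \<le> exp 1 * exp 1"
      by (intro mult_mono) auto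
    then show "(4 :: real) \<le> exp 2"
      by (simp add: exp_add[symmetric])
  qed auto
  also have "\<dots> = exp (5 * real n)"
    by (simp add: exp_of_nat_mult[symmetric] exp_add[symmetric] algebra_simps)
  finally show ?thesis .
qed

section \<open>Ungar's theorem\<close>

text \<open>For \<open>k\<close> up to \<open>b\<close> the window consists of the
  \<open>2 * k\<close> positions from \<open>b + 1 - k\<close> to \<open>b + k\<close>. Entries are
  integers because the cyclic argument uses negated positions as labels.\<close>

definition inc_mid :: "nat \<Rightarrow> nat \<Rightarrow> (nat \<Rightarrow> int) \<Rightarrow> bool" where
  "inc_mid b k u \<longleftrightarrow> (\<forall>i\<in>{b + 1 - k..<b + k}. u i < u (Suc i))"

definition dec_mid :: "nat \<Rightarrow> nat \<Rightarrow> (nat \<Rightarrow> int) \<Rightarrow> bool" where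
  "dec_mid b k u \<longleftrightarrow> (\<forall>i\<in>{b + 1 - k..<b + k}. u (Suc i) < u i)"

text \<open>
  A signed radius around the barrier between the positions \<open>b\<close> and \<open>b + 1\<close>: it is \<open>k\<close> if \<open>k \<ge> 1\<close> is the
  largest half-width of a centred increasing window, and \<open>1 - k\<close> if \<open>k \<ge> 1\<close> is the largest half-width of
  a centred decreasing window.  A move lowers it by at most one, except that a move in which \<open>d\<close>
  entries cross the barrier from left to right raises it by at least \<open>2 d - 1\<close>.
\<close>

definition radius_ge :: "nat \<Rightarrow> int \<Rightarrow> (nat \<Rightarrow> int) \<Rightarrow> bool" where
  "radius_ge b r u \<longleftrightarrow> (if r \<ge> 1 then inc_mid b (nat r) u else \<not> dec_mid b (nat (2 - r)) u)"

definition crossing :: "nat \<Rightarrow> (nat \<Rightarrow> nat) \<Rightarrow> nat" where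
  "crossing b \<beta> = card {i \<in> {1..b}. b < \<beta> i}"

lemma inc_mid_mono: "inc_mid b k u \<Longrightarrow> k' \<le> k \<Longrightarrow> inc_mid b k' u"
  unfolding inc_mid_def by auto

lemma dec_mid_mono: "dec_mid b k u \<Longrightarrow> k' \<le> k \<Longrightarrow> dec_mid b k' u"
  unfolding dec_mid_def by auto

lemma not_inc_mid_dec_mid: "inc_mid b k u \<Longrightarrow> dec_mid b k' u \<Longrightarrow> 0 < k \<Longrightarrow> 0 < k' \<Longrightarrow> False"
  unfolding inc_mid_def dec_mid_def by (drule bspec[of _ _ b], simp, drule bspec[of _ _ b], simp, simp)

lemma radius_ge_mono:
  assumes "radius_ge b r u" "r' \<le> r"
  shows "radius_ge b r' u"
proof (cases "1 \<le> r")
  case True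
  then have inc: "inc_mid b (nat r) u"
    using assms(1) by (simp add: radius_ge_def)
  show ?thesis
  proof (cases "1 \<le> r'")
    case True
    then show ?thesis
      using inc_mid_mono[OF inc, of "nat r'"] assms(2) by (simp add: radius_ge_def)
  next
    case False
    then show ?thesis
      using not_inc_mid_dec_mid[OF inc, of "nat (2 - r')"] \<open>1 \<le> r\<close> by (auto simp: radius_ge_def)
  qed
next
  case False
  moreover have "nat (2 - r) \<le> nat (2 - r')"
    using assms(2) by (intro nat_mono) simp
  ultimately show ?thesis
    using assms dec_mid_mono[of b "nat (2 - r')" u "nat (2 - r)"] by (auto simp: radius_ge_def)
qed

lemma radius_ge_dec_mid:
  assumes "radius_ge b r u" "dec_mid b d u" "1 \<le> d"
  shows "r \<le> 1 - int d"
proof -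
  have "\<not> 1 \<le> r"
    using assms not_inc_mid_dec_mid[of b "nat r" u d] by (auto simp: radius_ge_def)
  moreover have "\<not> nat (2 - r) \<le> d"
    using assms dec_mid_mono[OF assms(2)] calculation by (auto simp: radius_ge_def)
  ultimately show ?thesis
    by linarith
qed

lemma block_reversal_less:
  "block_reversal n T \<beta> \<Longrightarrow> i < j \<Longrightarrow> \<beta> j < \<beta> i \<longleftrightarrow> {i..<j} \<subseteq> T"
  by (simp add: block_reversal_def)

lemma block_reversal_invol: "block_reversal n T \<beta> \<Longrightarrow> \<beta> (\<beta> i) = i"
  by (simp add: block_reversal_def)

lemma block_reversal_inj: "block_reversal n T \<beta> \<Longrightarrow> inj \<beta>"
  by (metis block_reversal_invol injI)

lemma block_reversal_permutes: "block_reversal n T \<beta> \<Longrightarrow> \<beta> permutes {1..n}"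
  by (simp add: block_reversal_def)

lemma block_reversal_fixed:
  assumes \<beta>: "block_reversal n T \<beta>" and "i \<notin> T" "i - 1 \<notin> T"
  shows "\<beta> i = i"
proof (rule ccontr)
  assume "\<beta> i \<noteq> i"
  then consider "\<beta> i < i" | "i < \<beta> i"
    by linarith
  then show False
  proof cases
    case 1
    then have "\<not> {\<beta> i..<i} \<subseteq> T"
      using assms(3) by (auto simp: subset_eq intro!: bexI[of _ "i - 1"])
    then show False
      using block_reversal_less[OF \<beta> 1] block_reversal_invol[OF \<beta>, of i] 1 by simp
  next
    case 2
    then have "\<not> {i..<\<beta> i} \<subseteq> T"
      using assms(2) by auto
    then show False
      using block_reversal_less[OF \<beta> 2] block_reversal_invol[OF \<beta>, of i] 2 by simp
  qed
qed

text \<open>A move that chooses no gap inside the window fixes all of it except the two end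
  positions, which may still belong to blocks reaching outside. This is the loss of one per
  move.\<close>

lemma mid_fixed:
  assumes \<beta>: "block_reversal n T \<beta>" and out: "\<And>i. i \<in> {b + 1 - k..<b + k} \<Longrightarrow> i \<notin> T"
    and i: "i \<in> {b + 2 - k..<b + k}"
  shows "\<beta> i = i"
  using i by (intro block_reversal_fixed[OF \<beta>] out) auto

lemma decreasing_on_block:
  fixes u :: "nat \<Rightarrow> 'a :: order"
  assumes "i < j" "{i..<j} \<subseteq> T" and "\<And>l. l \<in> T \<Longrightarrow> u (Suc l) < u l"
  shows "u j < u i"
  using assms(1,2)
proof (induction i j rule: less_Suc_induct)
  case (1 i)
  then show ?case
    using assms(3) by auto
next
  case (2 i j k)
  then have "{i..<j} \<subseteq> T" "{j..<k} \<subseteq> T"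
    by auto
  with 2 show ?case
    by (meson less_trans)
qed

lemma increasing_after_reversal:
  fixes u :: "nat \<Rightarrow> 'a :: order"
  assumes \<beta>: "block_reversal n T \<beta>" and dec: "\<And>l. l \<in> T \<Longrightarrow> u (Suc l) < u l" and l: "l \<in> T"
  shows "u (\<beta> l) < u (\<beta> (Suc l))"
proof -
  have less: "\<beta> (Suc l) < \<beta> l"
    using block_reversal_less[OF \<beta>, of l "Suc l"] l by simp
  moreover have "{\<beta> (Suc l)..<\<beta> l} \<subseteq> T"
    using block_reversal_less[OF \<beta> less] by (simp add: block_reversal_invol[OF \<beta>])
  ultimately show ?thesis
    using dec by (rule decreasing_on_block)
qed

text \<open>Let \<open>i\<close> be the leftmost position that crosses and \<open>j\<close> the
  rightmost image. Their order is reversed, so they share a block; that block holds all crossing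
  positions on the left and all images on the right, hence at least
  \<open>crossing b \<beta>\<close> positions on each side.\<close>

lemma crossing_block:
  assumes \<beta>: "block_reversal n T \<beta>" and d: "1 \<le> crossing b \<beta>"
  shows "{b + 1 - crossing b \<beta>..<b + crossing b \<beta>} \<subseteq> T" "crossing b \<beta> \<le> b" "crossing b \<beta> \<le> n - b"
proof -
  let ?X = "{i \<in> {1..b}. b < \<beta> i}"
  let ?Y = "\<beta> ` ?X"
  have X: "finite ?X" "?X \<noteq> {}"
    using d unfolding crossing_def by (simp, metis card.empty not_one_le_zero)
  have cardY: "card ?Y = crossing b \<beta>"
    unfolding crossing_def using block_reversal_inj[OF \<beta>] by (intro card_image) (auto intro: inj_on_subset)
  have Y_sub: "?Y \<subseteq> {b + 1..n}"
  proof
    fix j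
    assume "j \<in> ?Y"
    then obtain i where i: "i \<in> {1..b}" "b < \<beta> i" "j = \<beta> i"
      by auto
    have "\<beta> i \<in> {1..n}"
    proof (rule ccontr)
      assume "\<beta> i \<notin> {1..n}"
      then have "\<beta> (\<beta> i) = \<beta> i"
        using block_reversal_permutes[OF \<beta>] by (simp add: permutes_def)
      then show False
        using i block_reversal_invol[OF \<beta>, of i] by simp
    qed
    with i show "j \<in> {b + 1..n}"
      by auto
  qed
  define i where "i = Min ?X"
  define j where "j = Max ?Y"
  have i: "i \<in> ?X" and X_sub: "?X \<subseteq> {i..b}"
    using Min_in[OF X] Min_le[OF X(1)] unfolding i_def by auto
  have j: "j \<in> ?Y" and Y_sub': "?Y \<subseteq> {b + 1..j}"
  proof -
    have "finite ?Y" "?Y \<noteq> {}"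
      using X by auto
    then show "j \<in> ?Y"
      unfolding j_def by (rule Max_in)
    show "?Y \<subseteq> {b + 1..j}"
      using Y_sub Max_ge[OF \<open>finite ?Y\<close>] unfolding j_def by auto
  qed
  have "crossing b \<beta> \<le> card {i..b}"
    unfolding crossing_def using X_sub by (intro card_mono) auto
  moreover have "crossing b \<beta> \<le> card {b + 1..j}"
    unfolding cardY[symmetric] using Y_sub' by (intro card_mono) auto
  moreover have "i \<le> b" "b < j"
    using i j Y_sub' by auto
  moreover have "\<beta> j \<le> b" "b < \<beta> i"
    using i j block_reversal_invol[OF \<beta>] by auto
  then have "{i..<j} \<subseteq> T"
    using block_reversal_less[OF \<beta>, of i j] \<open>i \<le> b\<close> \<open>b < j\<close> by simp
  ultimately show "{b + 1 - crossing b \<beta>..<b + crossing b \<beta>} \<subseteq> T"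
    by (intro order.trans[OF _ \<open>{i..<j} \<subseteq> T\<close>]) auto
  have "crossing b \<beta> \<le> card {1..b}"
    unfolding crossing_def by (intro card_mono) auto
  then show "crossing b \<beta> \<le> b"
    by simp
  have "crossing b \<beta> \<le> card {b + 1..n}"
    unfolding cardY[symmetric] using Y_sub by (intro card_mono) auto
  then show "crossing b \<beta> \<le> n - b"
    by simp
qed

text \<open>Chosen gaps are descents before the move and ascents after it. So without a crossing
  \<open>mid_fixed\<close> applies to an increasing window before the move, or to a decreasing
  window after it, which is then traced back. A crossing of order d takes the radius from at most 1
  - d to at least d.\<close>

lemma radius_ge_step:
  assumes \<beta>: "block_reversal n T \<beta>" and dec: "\<And>l. l \<in> T \<Longrightarrow> u (Suc l) < u l"
    and r: "radius_ge b r u"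
  shows "radius_ge b (r - 1 + 2 * int (crossing b \<beta>)) (u \<circ> \<beta>)"
proof (cases "crossing b \<beta> = 0")
  case True
  have notin_u: "i \<notin> T" if "inc_mid b k u" "i \<in> {b + 1 - k..<b + k}" for i k
    using that dec[of i] unfolding inc_mid_def by force
  have notin_u': "i \<notin> T" if "dec_mid b k (u \<circ> \<beta>)" "i \<in> {b + 1 - k..<b + k}" for i k
    using that increasing_after_reversal[of n T \<beta> u i, OF \<beta> dec] unfolding dec_mid_def by force
  have "radius_ge b (r - 1) (u \<circ> \<beta>)"
  proof (cases "2 \<le> r")
    case True
    then have inc: "inc_mid b (nat r) u"
      using r by (simp add: radius_ge_def)
    have "inc_mid b (nat (r - 1)) (u \<circ> \<beta>)"
      unfolding inc_mid_def
    proof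
      fix i
      assume i: "i \<in> {b + 1 - nat (r - 1)..<b + nat (r - 1)}"
      have "\<beta> i = i" "\<beta> (Suc i) = Suc i"
        using i True by (auto intro!: mid_fixed[OF \<beta> notin_u[OF inc]])
      moreover have "u i < u (Suc i)"
        using inc_mid_mono[OF inc, of "nat (r - 1)"] i True by (auto simp: inc_mid_def)
      ultimately show "(u \<circ> \<beta>) i < (u \<circ> \<beta>) (Suc i)"
        by simp
    qed
    then show ?thesis
      using True by (simp add: radius_ge_def)
  next
    case False
    have "\<not> dec_mid b (nat (3 - r)) (u \<circ> \<beta>)"
    proof
      assume dec': "dec_mid b (nat (3 - r)) (u \<circ> \<beta>)"
      have fixed: "\<beta> i = i" if "i \<in> {b + 2 - nat (3 - r)..<b + nat (3 - r)}" for i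
        by (rule mid_fixed[OF \<beta> notin_u'[OF dec'] that])
      have "dec_mid b (nat (2 - r)) u"
        unfolding dec_mid_def
      proof
        fix i
        assume i: "i \<in> {b + 1 - nat (2 - r)..<b + nat (2 - r)}"
        have "\<beta> i = i" "\<beta> (Suc i) = Suc i"
          using i False by (auto intro!: fixed)
        moreover have "(u \<circ> \<beta>) (Suc i) < (u \<circ> \<beta>) i"
          using dec_mid_mono[OF dec', of "nat (2 - r)"] i by (auto simp: dec_mid_def)
        ultimately show "u (Suc i) < u i"
          by simp
      qed
      moreover have "1 \<le> r \<Longrightarrow> inc_mid b (nat r) u" "\<not> 1 \<le> r \<Longrightarrow> \<not> dec_mid b (nat (2 - r)) u"
        using r by (auto simp: radius_ge_def)
      ultimately show False
        using not_inc_mid_dec_mid[of b "nat r" u "nat (2 - r)"] False by (cases "1 \<le> r") auto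
    qed
    then show ?thesis
      using False by (simp add: radius_ge_def)
  qed
  with True show ?thesis
    by simp
next
  case False
  let ?d = "crossing b \<beta>"
  have d: "1 \<le> ?d"
    using False by simp
  note block = crossing_block(1)[OF \<beta> d]
  have "dec_mid b ?d u"
    using block dec by (auto simp: dec_mid_def)
  with r d have "r \<le> 1 - int ?d"
    by (intro radius_ge_dec_mid)
  moreover have "inc_mid b ?d (u \<circ> \<beta>)"
    using block increasing_after_reversal[of n T \<beta> u, OF \<beta> dec] by (auto simp: inc_mid_def)
  then have "radius_ge b (int ?d) (u \<circ> \<beta>)"
    using d by (simp add: radius_ge_def)
  ultimately show ?thesis
    by (elim radius_ge_mono) simp
qed

lemma radius_ge_path:
  assumes "s \<le> e" and \<beta>: "\<And>t. s \<le> t \<Longrightarrow> t < e \<Longrightarrow> block_reversal n (T t) (\<beta> t)"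
    and dec: "\<And>t l. s \<le> t \<Longrightarrow> t < e \<Longrightarrow> l \<in> T t \<Longrightarrow> u t (Suc l) < u t l"
    and step: "\<And>t. s \<le> t \<Longrightarrow> t < e \<Longrightarrow> u (Suc t) = u t \<circ> \<beta> t"
    and r: "radius_ge b r (u s)"
  shows "radius_ge b (r - int (e - s) + 2 * (\<Sum>t\<in>{s..<e}. int (crossing b (\<beta> t)))) (u e)"
  using assms(1) \<beta> dec step
proof (induction e rule: dec_induct)
  case base
  show ?case
    using r by simp
next
  case (step e)
  have "radius_ge b (r - int (e - s) + 2 * (\<Sum>t\<in>{s..<e}. int (crossing b (\<beta> t)))) (u e)"
    using step by simp
  then have "radius_ge b (r - int (e - s) + 2 * (\<Sum>t\<in>{s..<e}. int (crossing b (\<beta> t))) - 1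
      + 2 * int (crossing b (\<beta> e))) (u e \<circ> \<beta> e)"
    using step by (intro radius_ge_step[where T = "T e"]) auto
  moreover have "u (Suc e) = u e \<circ> \<beta> e"
    by (rule step.prems(3)) (use step.hyps in auto)
  moreover have "r - int (e - s) + 2 * (\<Sum>t\<in>{s..<e}. int (crossing b (\<beta> t))) - 1 + 2 * int (crossing b (\<beta> e)) =
      r - int (Suc e - s) + 2 * (\<Sum>t\<in>{s..<Suc e}. int (crossing b (\<beta> t)))"
    using step.hyps(1) by (simp add: Suc_diff_le)
  ultimately show ?case
    by (simp only:)
qed

section \<open>Sequences of moves from the top to the bottom\<close>

locale ungarian_path =
  fixes n m :: nat and x :: "nat \<Rightarrow> nat \<Rightarrow> nat" and T :: "nat \<Rightarrow> nat set" and \<beta> :: "nat \<Rightarrow> nat \<Rightarrow> nat"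
  assumes block: "\<And>t. t < m \<Longrightarrow> block_reversal n (T t) (\<beta> t)"
    and descents: "\<And>t. t < m \<Longrightarrow> T t \<subseteq> descents n (x t)"
    and step: "\<And>t. t < m \<Longrightarrow> x (Suc t) = x t \<circ> \<beta> t"
    and start: "x 0 = reverse_perm n"
    and finish: "x m = id"
    and no_jump: "\<And>t. t < m \<Longrightarrow> \<not> (x t = reverse_perm n \<and> x (Suc t) = id)"
begin

lemma permutes: "t \<le> m \<Longrightarrow> x t permutes {1..n}"
proof (induction t)
  case 0
  then show ?case
    by (simp add: start reverse_perm_permutes)
next
  case (Suc t)
  then have "x t \<circ> \<beta> t permutes {1..n}"
    by (intro permutes_compose block_reversal_permutes[OF block]) auto
  with Suc.prems show ?case
    using step[of t] by (simp only: Suc_le_eq)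
qed

lemma inversions_antimono:
  assumes "s \<le> t" "t \<le> m"
  shows "inversions (x t) \<subseteq> inversions (x s)"
  using assms
proof (induction t rule: dec_induct)
  case (step t)
  have "(weak_cover n)\<^sup>*\<^sup>* (x t \<circ> \<beta> t) (x t)"
    using block_reversal_le(1)[OF permutes descents block, of t] step by simp
  then have "(weak_cover n)\<^sup>*\<^sup>* (x (Suc t)) (x t)"
    using ungarian_path.step[OF ungarian_path_axioms, of t] step by simp
  then have "inversions (x (Suc t)) \<subseteq> inversions (x t)"
    using weak_order_le_iff[OF permutes permutes, of "Suc t" t] step by simp
  with step show ?case
    by simp
qed simp

lemma descent_less: "t < m \<Longrightarrow> l \<in> T t \<Longrightarrow> x t (Suc l) < x t l"
  using descents[of t] by (auto simp: descents_def)

text \<open>This fact and its companion for later times relabel entries by their position at time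
  \<open>s\<close>. Inversions only disappear, so a pair about to be reversed was inverted at all
  earlier times and, once reversed, is never inverted again. With a suitable sign the labels thus
  decrease on the chosen blocks, as \<open>radius_ge_step\<close> demands.\<close>

lemma descent_position_before:
  assumes "s \<le> t" "t < m" "l \<in> T t"
  shows "inv (x s) (x t l) < inv (x s) (x t (Suc l))"
proof -
  have "(x t (Suc l), x t l) \<in> inversions (x t)"
    using assms descent_less[of t l] by (simp add: inversions_iff[OF permutes])
  then have "(x t (Suc l), x t l) \<in> inversions (x s)"
    using inversions_antimono[of s t] assms by auto
  then show ?thesis
    by (simp add: inversions_def)
qed

lemma descent_position_after:
  assumes "t < s" "s \<le> m" "l \<in> T t"
  shows "inv (x s) (x t (Suc l)) < inv (x s) (x t l)"
proof -
  have t: "t < m"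
    using assms by simp
  note b = block[OF t]
  have p: "x s permutes {1..n}"
    using assms(2) by (rule permutes)
  have less: "\<beta> t (Suc l) < \<beta> t l"
    using block_reversal_less[OF b, of l "Suc l"] assms by simp
  have eq: "x t i = x (Suc t) (\<beta> t i)" for i
    using step[OF t] block_reversal_invol[OF b] by simp
  have "(x t (Suc l), x t l) \<notin> inversions (x (Suc t))"
    using inversions_iff[OF permutes, of "Suc t" "\<beta> t (Suc l)" "\<beta> t l"] t less by (simp add: eq)
  then have "(x t (Suc l), x t l) \<notin> inversions (x s)"
    using inversions_antimono[of "Suc t" s] assms by auto
  moreover have "x t (Suc l) < x t l"
    using descent_less[OF t assms(3)] .
  moreover from this have "inv (x s) (x t (Suc l)) \<noteq> inv (x s) (x t l)"
    using permutes_inj[OF permutes_inv[OF p]] by (simp add: inj_eq)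
  ultimately show ?thesis
    by (simp add: inversions_def)
qed

abbreviation d :: "nat \<Rightarrow> nat \<Rightarrow> nat" where
  "d b t \<equiv> crossing b (\<beta> t)"

text \<open>The radius is at least \<open>d b c\<close> right after move \<open>c\<close> and at
  most \<open>1 - d b e\<close> right before move \<open>e\<close>. Each of the
  \<open>e - c - 1\<close> moves between lowers it by at most one, up to a gain of
  \<open>2 * d b t\<close> from crossings; the crossings in between are thus accounted for at
  once.\<close>

lemma crossing_span:
  assumes "c \<le> e" "e < m" "1 \<le> d b c" "1 \<le> d b e"
  shows "2 * (\<Sum>t\<in>{c..e}. d b t) \<le> e - c + d b c + d b e"
proof (cases "c = e")
  case False
  with assms(1) have ce: "c < e"
    by simp
  let ?u = "\<lambda>t i. int (x t i)"
  have "inc_mid b (d b c) (?u (Suc c))"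
    using crossing_block(1)[OF block assms(3)] assms(2) ce
      increasing_after_reversal[of n "T c" "\<beta> c" "x c", OF block descent_less]
    by (auto simp: inc_mid_def step)
  then have "radius_ge b (int (d b c)) (?u (Suc c))"
    using assms(3) by (simp add: radius_ge_def)
  then have "radius_ge b (int (d b c) - int (e - Suc c) + 2 * (\<Sum>t\<in>{Suc c..<e}. int (d b t))) (?u e)"
    using ce assms(2) by (intro radius_ge_path[where n = n and T = T and \<beta> = \<beta>]) (auto simp: block descent_less step)
  moreover have "dec_mid b (d b e) (?u e)"
    using crossing_block(1)[OF block assms(4)] assms(2) descent_less[of e] by (auto simp: dec_mid_def)
  ultimately have "int (d b c) - int (e - Suc c) + 2 * (\<Sum>t\<in>{Suc c..<e}. int (d b t)) \<le> 1 - int (d b e)"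
    using assms(4) by (rule radius_ge_dec_mid)
  then have "int (d b c + d b e + 2 * (\<Sum>t\<in>{Suc c..<e}. d b t)) \<le> int (e - c)"
    using ce by simp
  then have "d b c + d b e + 2 * (\<Sum>t\<in>{Suc c..<e}. d b t) \<le> e - c"
    by (simp only: of_nat_le_iff)
  moreover have "{c..e} = insert c (insert e {Suc c..<e})"
    using ce by auto
  then have "(\<Sum>t\<in>{c..e}. d b t) = d b c + d b e + (\<Sum>t\<in>{Suc c..<e}. d b t)"
    using ce by simp
  ultimately show ?thesis
    by simp
qed simp

text \<open>
  The path is continued past the bottom by the mirror images \<open>x t \<circ> reverse_perm n\<close>, which turns the barrier
  \<open>b\<close> into \<open>n - b\<close>.  Entries are compared by their positions at time \<open>c\<close>: a pair reversed at time \<open>c\<close>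
  is not reversed again before the continued path returns to time \<open>c\<close>.
\<close>

lemma crossing_wrap:
  assumes "c' < c" "c < m" "1 \<le> d b c" "1 \<le> d (n - b) c'" and b: "b \<le> n"
  shows "d b c + d (n - b) c' \<le> m - c + c'"
proof -
  let ?p = "inv (x c)"
  let ?u = "\<lambda>t i. - int (?p (x t i))"
  let ?v = "\<lambda>t i. int (?p (x t i))"
  let ?r = "int (d b c) - int (m - Suc c)"
  have p: "?p permutes {1..n}"
    using permutes[of c] assms by (intro permutes_inv) simp
  have pc: "?p (x c i) = i" for i
    using permutes[of c] assms by (simp add: permutes_inverses)
  have "inc_mid b (d b c) (?u (Suc c))"
    using crossing_block(1)[OF block assms(3)] assms block_reversal_less[OF block, of c]
    by (auto simp: inc_mid_def step pc)
  then have "radius_ge b (int (d b c)) (?u (Suc c))"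
    using assms(3) by (simp add: radius_ge_def)
  then have "radius_ge b (?r + 2 * (\<Sum>t\<in>{Suc c..<m}. int (d b t))) (?u m)"
    using assms(2) by (intro radius_ge_path[where n = n and T = T and \<beta> = \<beta>])
      (auto simp: block descent_position_before step)
  then have u_m: "radius_ge b ?r (?u m)"
    by (rule radius_ge_mono) (simp add: sum_nonneg)
  have um: "?u m i = - int (?p i)" for i
    by (simp add: finish)
  have v0: "?v 0 j = int (?p (n + 1 - j))" if "1 \<le> j" "j \<le> n" for j
    using that by (simp add: start reverse_perm_def)
  \<comment> \<open>The seam: the reflection of \<open>i\<close> to \<open>n + 1 - i\<close> relates
    the final arrangement to the initial one. It turns the barrier \<open>b\<close> into
    \<open>n - b\<close> and, as it reverses direction, negated labels into plain ones, so the
    radius bound carries over.\<close>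
  have v_0: "radius_ge (n - b) ?r (?v 0)"
  proof (cases "1 \<le> ?r")
    case True
    define k where "k = nat ?r"
    have k: "1 \<le> k" "k \<le> b" "k \<le> n - b"
      using True crossing_block(2,3)[OF block assms(3)] assms(2) by (auto simp: k_def)
    have inc: "inc_mid b k (?u m)"
      using u_m True by (simp add: radius_ge_def k_def)
    have "inc_mid (n - b) k (?v 0)"
      unfolding inc_mid_def
    proof
      fix j
      assume j: "j \<in> {n - b + 1 - k..<n - b + k}"
      then have jn: "1 \<le> j" "Suc j \<le> n" "n - j \<in> {b + 1 - k..<b + k}"
        using k by auto
      have "?u m (n - j) < ?u m (Suc (n - j))"
        using inc jn(3) unfolding inc_mid_def by blast
      moreover have "n + 1 - j = Suc (n - j)" "n + 1 - Suc j = n - j"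
        using jn by auto
      ultimately show "?v 0 j < ?v 0 (Suc j)"
        using jn v0[of j] v0[of "Suc j"] by (simp add: um)
    qed
    then show ?thesis
      using True by (simp add: radius_ge_def k_def)
  next
    case False
    define k where "k = nat (2 - ?r)"
    have "\<not> dec_mid (n - b) k (?v 0)"
    proof
      assume dec: "dec_mid (n - b) k (?v 0)"
      have "2 \<le> k"
        using False by (simp add: k_def)
      \<comment> \<open>A decreasing window cannot leave \<open>{1..n}\<close>: the fixed points
        \<open>0\<close> and \<open>n + 1\<close> carry labels below and above all others. This
        matters because \<open>reverse_perm n\<close> is a reflection only inside.\<close>
      have "k \<le> n - b"
      proof (rule ccontr)
        assume "\<not> k \<le> n - b"
        then have "?v 0 (Suc 0) < ?v 0 0"
          using dec unfolding dec_mid_def by (auto dest: bspec[of _ _ 0])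
        moreover have "?v 0 0 = 0"
          using p by (simp add: start reverse_perm_def permutes_def)
        ultimately show False
          by simp
      qed
      have "k \<le> b"
      proof (rule ccontr)
        assume "\<not> k \<le> b"
        then have "n \<in> {n - b + 1 - k..<n - b + k}"
          using b \<open>k \<le> n - b\<close> \<open>2 \<le> k\<close> by auto
        then have "?v 0 (Suc n) < ?v 0 n"
          using dec unfolding dec_mid_def by blast
        moreover have "?v 0 (Suc n) = int (Suc n)"
          using p by (simp add: start reverse_perm_def permutes_def)
        moreover have "?v 0 n \<le> int n"
          using permutes_in_image[OF p, of 1] v0[of n] \<open>2 \<le> k\<close> \<open>k \<le> n - b\<close> by auto
        ultimately show False
          by simp
      qed
      have "dec_mid b k (?u m)"
        unfolding dec_mid_def
      proof
        fix i
        assume i: "i \<in> {b + 1 - k..<b + k}"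
        then have "n - i \<in> {n - b + 1 - k..<n - b + k}" "1 \<le> i" "i < n"
          using \<open>k \<le> b\<close> \<open>k \<le> n - b\<close> b by auto
        then have "?v 0 (Suc (n - i)) < ?v 0 (n - i)"
          using dec unfolding dec_mid_def by blast
        then show "?u m (Suc i) < ?u m i"
          using \<open>1 \<le> i\<close> \<open>i < n\<close> v0[of "n - i"] v0[of "Suc (n - i)"] by (simp add: um Suc_eq_plus1_left)
      qed
      with u_m False show False
        by (simp add: radius_ge_def k_def)
    qed
    with False show ?thesis
      by (simp add: radius_ge_def k_def)
  qed
  have after: "?v t (Suc l) < ?v t l" if "t \<le> c'" "l \<in> T t" for t l
    using that assms descent_position_after[of t c l] by simp
  have "radius_ge (n - b) (?r - int (c' - 0) + 2 * (\<Sum>t\<in>{0..<c'}. int (d (n - b) t))) (?v c')"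
    using v_0 assms(1,2) after
    by (intro radius_ge_path[where n = n and T = T and \<beta> = \<beta>]) (auto simp: block step)
  then have "radius_ge (n - b) (?r - int c') (?v c')"
    by (rule radius_ge_mono) (simp add: sum_nonneg)
  moreover have "dec_mid (n - b) (d (n - b) c') (?v c')"
    using crossing_block(1)[OF block assms(4)] assms(1,2) after[of c'] by (auto simp: dec_mid_def)
  ultimately have "?r - int c' \<le> 1 - int (d (n - b) c')"
    using assms(4) by (rule radius_ge_dec_mid)
  then show ?thesis
    using assms(2) by linarith
qed

text \<open>The number of values above \<open>b\<close> in the first \<open>b\<close> positions
  starts at \<open>min b (n - b)\<close> or more and ends at 0, and a move lowers it by at most its
  crossing order.\<close>

lemma sum_crossing_ge:
  assumes "b \<le> n"
  shows "min b (n - b) \<le> (\<Sum>t<m. d b t)"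
proof -
  define h where "h t = card {i \<in> {1..b}. b < x t i}" for t
  have "h t \<le> h (Suc t) + d b t" if t: "t < m" for t
  proof -
    have "{i \<in> {1..b}. b < x t i} \<subseteq> {i \<in> {1..b}. b < \<beta> t i} \<union> \<beta> t ` {i \<in> {1..b}. b < x (Suc t) i}"
    proof
      fix i
      assume i: "i \<in> {i \<in> {1..b}. b < x t i}"
      have "\<beta> t i \<in> {1..n}"
        using i assms permutes_in_image[OF block_reversal_permutes[OF block[OF t]], of i] by auto
      moreover have "\<beta> t (\<beta> t i) = i"
        by (rule block_reversal_invol[OF block[OF t]])
      ultimately show "i \<in> {i \<in> {1..b}. b < \<beta> t i} \<union> \<beta> t ` {i \<in> {1..b}. b < x (Suc t) i}"
        using i step[OF t] by (cases "b < \<beta> t i") (auto intro!: image_eqI[of _ _ "\<beta> t i"])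
    qed
    then have "h t \<le> card ({i \<in> {1..b}. b < \<beta> t i} \<union> \<beta> t ` {i \<in> {1..b}. b < x (Suc t) i})"
      unfolding h_def by (intro card_mono) auto
    also have "\<dots> \<le> d b t + card (\<beta> t ` {i \<in> {1..b}. b < x (Suc t) i})"
      unfolding crossing_def by (rule card_Un_le)
    also have "\<dots> \<le> d b t + h (Suc t)"
      unfolding h_def by (intro add_left_mono card_image_le) auto
    finally show ?thesis
      by simp
  qed
  note hs = this
  have "h 0 \<le> h t + (\<Sum>s<t. d b s)" if "t \<le> m" for t
    using that
  proof (induction t)
    case (Suc t)
    then have "h 0 \<le> h t + (\<Sum>s<t. d b s)" "h t \<le> h (Suc t) + d b t"
      using hs[of t] by auto
    then show ?case
      by simp
  qed simp
  from this[of m] have "h 0 \<le> h m + (\<Sum>t<m. d b t)"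
    by simp
  moreover have "h m = 0"
    by (simp add: h_def finish)
  moreover have "min b (n - b) \<le> h 0"
  proof -
    have "card {1..min b (n - b)} \<le> h 0"
      unfolding h_def using assms by (intro card_mono) (auto simp: start reverse_perm_def)
    then show ?thesis
      by simp
  qed
  ultimately show ?thesis
    by simp
qed

lemma no_crossing:
  assumes "t < m" "b \<le> n" "d b t = 0" "i \<in> {1..b}"
  shows "\<beta> t i \<in> {1..b}"
proof -
  have "\<beta> t i \<in> {1..n}"
    using assms permutes_in_image[OF block_reversal_permutes[OF block[OF assms(1)]], of i] by auto
  moreover have "\<not> b < \<beta> t i"
    using assms(3,4) unfolding crossing_def by auto
  ultimately show ?thesis
    by auto
qed

text \<open>Otherwise all of the last \<open>b\<close> entries would have to cross both barriers in one move, which would be the excluded jump.\<close>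

lemma first_crossing_less_last:
  assumes b: "1 \<le> b" "b < n" "b \<le> n - b + 1" and c: "c < m" and c': "c' < m"
    and before: "\<And>t. t < c' \<Longrightarrow> d (n - b) t = 0"
    and after: "\<And>t. c < t \<Longrightarrow> t < m \<Longrightarrow> d b t = 0"
  shows "c' < c"
proof (rule ccontr)
  assume "\<not> c' < c"
  then have cc': "c \<le> c'"
    by simp
  note bc = block[OF c]
  \<comment> \<open>Before move \<open>c\<close> nothing crosses \<open>n - b\<close>, so the first
    \<open>n - b\<close> positions still hold values above \<open>b\<close>. After it nothing
    crosses \<open>b\<close>, so the first \<open>b\<close> positions already hold values up to
    \<open>b\<close>. Hence move \<open>c\<close> maps the first \<open>b\<close> positions onto the
    last \<open>b\<close>.\<close>
  have large: "\<forall>i\<in>{1..n - b}. b < x t i" if "t \<le> c" for t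
    using that
  proof (induction t)
    case 0
    then show ?case
      using b by (auto simp: start reverse_perm_def)
  next
    case (Suc t)
    then show ?case
      using no_crossing[of t "n - b"] before[of t] c cc' step[of t] by auto
  qed
  have small: "\<forall>i\<in>{1..b}. x t i \<le> b" if "Suc c \<le> t" "t \<le> m" for t
    using that(2,1)
  proof (induction t rule: inc_induct)
    case base
    then show ?case
      by (simp add: finish)
  next
    case (step t)
    then have t: "t < m" "d b t = 0"
      using after[of t] by auto
    have "x t i = x (Suc t) (\<beta> t i)" for i
      using ungarian_path.step[OF ungarian_path_axioms t(1)] block_reversal_invol[OF block[OF t(1)]] by simp
    then show ?case
      using step no_crossing[of t b] t b by auto
  qed
  have right: "\<beta> c i \<in> {n - b + 1..n}" if i: "i \<in> {1..b}" for i
  proof -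
    have "\<beta> c i \<in> {1..n}"
      using b i permutes_in_image[OF block_reversal_permutes[OF bc], of i] by auto
    moreover have "x c (\<beta> c i) \<le> b"
      using small[of "Suc c"] c i step[OF c] by auto
    then have "\<beta> c i \<notin> {1..n - b}"
      using large[of c] by fastforce
    ultimately show ?thesis
      by auto
  qed
  have "\<beta> c ` {1..b} = {n - b + 1..n}"
  proof (rule card_subset_eq)
    have "card (\<beta> c ` {1..b}) = card {1..b}"
      using block_reversal_inj[OF bc] by (intro card_image) (auto intro: inj_on_subset)
    then show "card (\<beta> c ` {1..b}) = card {n - b + 1..n}"
      using b by simp
  qed (use right in auto)
  moreover have "n \<in> {n - b + 1..n}"
    using b by auto
  ultimately obtain i where i: "i \<in> {1..b}" "\<beta> c i = n"
    by (metis imageE)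
  then have "\<beta> c n \<le> b"
    using block_reversal_invol[OF bc, of i] by simp
  moreover have "n - b + 1 \<le> \<beta> c 1"
    using right[of 1] b by simp
  moreover have "\<beta> c 1 \<noteq> \<beta> c n"
    using block_reversal_inj[OF bc] b by (auto simp: inj_eq)
  \<comment> \<open>For odd \<open>n\<close> the two ranges may share the middle position, as
    \<open>b\<close> can equal \<open>n - b + 1\<close>; injectivity makes the inequality
    strict.\<close>
  ultimately have "\<beta> c n < \<beta> c 1"
    using b by linarith
  then have full: "{1..<n} \<subseteq> T c"
    using block_reversal_less[OF bc, of 1 n] b by simp
  have pc: "x c permutes {1..n}" "x (Suc c) permutes {1..n}"
    using c by (auto intro: permutes)
  have "x c \<circ> reverse_perm n = id"
  proof (rule permutes_strict_mono_imp_id)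
    show "x c \<circ> reverse_perm n permutes {1..n}"
      using pc(1) reverse_perm_permutes by (intro permutes_compose)
    fix i
    assume i: "i \<in> {1..<n}"
    then have "n - i \<in> T c"
      using full by auto
    then have "x c (Suc (n - i)) < x c (n - i)"
      using descent_less[OF c] by simp
    moreover have "n + 1 - i = Suc (n - i)" "n + 1 - Suc i = n - i"
      using i by auto
    ultimately show "(x c \<circ> reverse_perm n) i < (x c \<circ> reverse_perm n) (Suc i)"
      using i by (simp add: reverse_perm_def)
  qed
  then have "x c i = reverse_perm n i" for i
    using reverse_perm_invol[of n i] by (metis comp_apply id_apply)
  then have "x c = reverse_perm n"
    by blast
  moreover have "x (Suc c) = id"
  proof (rule permutes_strict_mono_imp_id[OF pc(2)])
    fix i
    assume "i \<in> {1..<n}"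
    then show "x (Suc c) i < x (Suc c) (Suc i)"
      using increasing_after_reversal[of n "T c" "\<beta> c" "x c" i, OF bc descent_less[OF c]] full step[OF c] by auto
  qed
  ultimately show False
    using no_jump[OF c] by simp
qed

text \<open>Add the spans at the barriers \<open>N\<close> and \<open>n - N\<close> and the two
  wraps leading from the last crossing of one to the first crossing of the other. Crossing orders
  and times cancel and leave \<open>4 * N <= 2 * m\<close>. For even \<open>n\<close> the barriers
  coincide.\<close>

theorem length_ge:
  assumes "2 \<le> n"
  shows "2 * (n div 2) \<le> m"
proof -
  define N where "N = n div 2"
  have N: "1 \<le> N" "N \<le> n" "n - (n - N) = N" "N \<le> n - N" "n - N \<le> N + 1"
    using assms by (auto simp: N_def)
  define S where "S b = {t. t < m \<and> 1 \<le> d b t}" for b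
  have fin: "finite (S b)" for b
    unfolding S_def by simp
  have sum_ge: "N \<le> (\<Sum>t<m. d b t)" if "b = N \<or> b = n - N" for b
    using that sum_crossing_ge[of b] N by auto
  have ne: "S b \<noteq> {}" if "b = N \<or> b = n - N" for b
  proof
    assume "S b = {}"
    then have "(\<Sum>t<m. d b t) = 0"
      by (auto simp: S_def)
    then show False
      using sum_ge[OF that] N by simp
  qed
  define f where "f b = Min (S b)" for b
  define l where "l b = Max (S b)" for b
  have f: "f b < m" "1 \<le> d b (f b)" and l: "l b < m" "1 \<le> d b (l b)" and fl: "f b \<le> l b"
    and before: "\<And>t. t < f b \<Longrightarrow> d b t = 0" and after: "\<And>t. l b < t \<Longrightarrow> t < m \<Longrightarrow> d b t = 0"
    if "b = N \<or> b = n - N" for b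
  proof -
    have "f b \<in> S b" "l b \<in> S b"
      unfolding f_def l_def using fin ne[OF that] by auto
    then show "f b < m" "1 \<le> d b (f b)" "l b < m" "1 \<le> d b (l b)"
      by (auto simp: S_def)
    show "f b \<le> l b"
      unfolding f_def using fin \<open>l b \<in> S b\<close> by simp
    show "d b t = 0" if "t < f b" for t
    proof (rule ccontr)
      assume "d b t \<noteq> 0"
      then have "t \<in> S b"
        using that \<open>f b < m\<close> by (auto simp: S_def)
      then show False
        using that Min_le[OF fin] unfolding f_def by (meson not_le)
    qed
    show "d b t = 0" if "l b < t" "t < m" for t
    proof (rule ccontr)
      assume "d b t \<noteq> 0"
      then have "t \<in> S b"
        using that by (auto simp: S_def)
      then show False
        using that Max_ge[OF fin] unfolding l_def by (meson not_le)
    qed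
  qed
  have span: "2 * N \<le> l b - f b + d b (f b) + d b (l b)" if "b = N \<or> b = n - N" for b
  proof -
    have "(\<Sum>t<m. d b t) = (\<Sum>t\<in>{f b..l b}. d b t)"
      using before[OF that] after[OF that] l(1)[OF that]
      by (intro sum.mono_neutral_right) (auto simp: not_le)
    then show ?thesis
      using sum_ge[OF that] crossing_span[OF fl[OF that] l(1)[OF that] f(2)[OF that] l(2)[OF that]]
      by linarith
  qed
  have wrap: "d b (l b) + d (n - b) (f (n - b)) \<le> m - l b + f (n - b)" if "b = N \<or> b = n - N" for b
  proof -
    have b': "n - b = N \<or> n - b = n - N"
      using that N by auto
    have "f (n - b) < l b"
    proof (rule first_crossing_less_last)
      show "1 \<le> b" "b < n" "b \<le> n - b + 1"
        using that N assms by auto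
      show "l b < m" "f (n - b) < m"
        using f(1)[OF b'] l(1)[OF that] by auto
    qed (use before[OF b'] after[OF that] in auto)
    then show ?thesis
      using that N f(2)[OF b'] l[OF that] by (intro crossing_wrap) auto
  qed
  have "d (n - N) (l (n - N)) + d N (f N) \<le> m - l (n - N) + f N"
    using wrap[of "n - N"] N(3) by simp
  moreover have "d N (l N) + d (n - N) (f (n - N)) \<le> m - l N + f (n - N)"
    "2 * N \<le> l N - f N + d N (f N) + d N (l N)"
    "2 * N \<le> l (n - N) - f (n - N) + d (n - N) (f (n - N)) + d (n - N) (l (n - N))"
    "f N \<le> l N" "l N < m" "f (n - N) \<le> l (n - N)" "l (n - N) < m"
    using wrap[of N] span[of N] span[of "n - N"] fl l(1) by blast+
  ultimately have "2 * N + 2 * N \<le> m + m"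
    by linarith
  then show ?thesis
    by (simp add: N_def)
qed

end

section \<open>The Ungarian Markov chain of the weak order\<close>

definition block_rev :: "nat \<Rightarrow> nat set \<Rightarrow> nat \<Rightarrow> nat" where
  "block_rev n T = (SOME \<beta>. block_reversal n T \<beta>)"

lemma block_reversal_block_rev: "T \<subseteq> {1..<n} \<Longrightarrow> block_reversal n T (block_rev n T)"
  unfolding block_rev_def using block_reversal_exists by (rule someI_ex)

lemma descents_subset: "descents n x \<subseteq> {1..<n}"
  by (auto simp: descents_def)

lemma finite_descents: "finite (descents n x)"
  using descents_subset by (rule finite_subset) simp

lemma finite_covered_set: "x permutes {1..n} \<Longrightarrow> finite (covered_set (weak_order n) x)"
  by (simp add: covered_set_weak_order finite_descents)

lemma ungarian_step_weak_order:
  assumes x: "x permutes {1..n}"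
  shows "ungarian_step p (weak_order n) x =
    map_pmf (\<lambda>f. x \<circ> block_rev n {i \<in> descents n x. f (x \<circ> Transposition.transpose i (Suc i))})
      (Pi_pmf (covered_set (weak_order n) x) False (\<lambda>_. bernoulli_pmf p))"
  unfolding ungarian_step_def Let_def
proof (intro map_pmf_cong refl)
  fix f
  let ?s = "\<lambda>i. x \<circ> Transposition.transpose i (Suc i)"
  let ?T = "{i \<in> descents n x. f (?s i)}"
  have "{y \<in> covered_set (weak_order n) x. f y} = ?s ` ?T"
    unfolding covered_set_weak_order[OF x] by blast
  moreover have "?T \<subseteq> {1..<n}"
    using descents_subset by blast
  ultimately show "\<Sqinter>\<^bsub>weak_order n\<^esub> ({x} \<union> {y \<in> covered_set (weak_order n) x. f y}) = x \<circ> block_rev n ?T"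
    using meet_block_reversal[OF x _ block_reversal_block_rev, of ?T] by simp
qed

lemma set_pmf_ungarian_step:
  assumes "x permutes {1..n}" "y \<in> set_pmf (ungarian_step p (weak_order n) x)"
  obtains T where "T \<subseteq> descents n x" "y = x \<circ> block_rev n T"
proof -
  from assms obtain f where
    "y = x \<circ> block_rev n {i \<in> descents n x. f (x \<circ> Transposition.transpose i (Suc i))}"
    unfolding ungarian_step_weak_order[OF assms(1)] set_map_pmf by blast
  then show ?thesis
    by (intro that) auto
qed

lemma ungarian_step_permutes:
  assumes "x permutes {1..n}" "y \<in> set_pmf (ungarian_step p (weak_order n) x)"
  shows "y permutes {1..n}"
proof -
  from assms obtain T where "T \<subseteq> descents n x" and y: "y = x \<circ> block_rev n T"
    by (rule set_pmf_ungarian_step)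
  then have "block_reversal n T (block_rev n T)"
    using descents_subset by (intro block_reversal_block_rev) blast
  with assms(1) show ?thesis
    unfolding y by (intro permutes_compose) (auto simp: block_reversal_def)
qed

section \<open>Upper bound for the expected number of steps\<close>

lemma prob_descent_chosen:
  assumes x: "x permutes {1..n}" and l: "l \<in> descents n x" and p: "0 \<le> p" "p \<le> 1"
  shows "p \<le> measure_pmf.prob (ungarian_step p (weak_order n) x)
    {y. (weak_cover n)\<^sup>*\<^sup>* y (x \<circ> Transposition.transpose l (Suc l))}"
proof -
  let ?A = "{y. (weak_cover n)\<^sup>*\<^sup>* y (x \<circ> Transposition.transpose l (Suc l))}"
  let ?s = "\<lambda>i. x \<circ> Transposition.transpose i (Suc i)"
  let ?C = "covered_set (weak_order n) x"
  let ?P = "Pi_pmf ?C False (\<lambda>_. bernoulli_pmf p)"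
  have s: "?s l \<in> ?C"
    unfolding covered_set_weak_order[OF x] using l by blast
  have "map_pmf (\<lambda>f. f (?s l)) ?P = bernoulli_pmf p"
    using s finite_covered_set[OF x] by (subst Pi_pmf_component) auto
  then have "measure_pmf.prob ?P ((\<lambda>f. f (?s l)) -` {True}) = measure_pmf.prob (bernoulli_pmf p) {True}"
    by (metis measure_map_pmf)
  also have "\<dots> = p"
    using p by (simp add: measure_pmf_single)
  finally have "p = measure_pmf.prob ?P ((\<lambda>f. f (?s l)) -` {True})"
    by simp
  \<comment> \<open>Once the coin of \<open>l\<close> succeeds, the meet lies below the swap at
    \<open>l\<close>, whatever the other coins show.\<close>
  also have "\<dots> \<le> measure_pmf.prob ?P ((\<lambda>f. x \<circ> block_rev n {i \<in> descents n x. f (?s i)}) -` ?A)"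
  proof (intro measure_pmf.finite_measure_mono)
    show "(\<lambda>f. f (?s l)) -` {True} \<subseteq> (\<lambda>f. x \<circ> block_rev n {i \<in> descents n x. f (?s i)}) -` ?A"
    proof
      fix f
      assume "f \<in> (\<lambda>f. f (?s l)) -` {True}"
      then have "l \<in> {i \<in> descents n x. f (?s i)}"
        using l by simp
      moreover have "block_reversal n {i \<in> descents n x. f (?s i)} (block_rev n {i \<in> descents n x. f (?s i)})"
        using descents_subset by (intro block_reversal_block_rev) blast
      ultimately have "(weak_cover n)\<^sup>*\<^sup>* (x \<circ> block_rev n {i \<in> descents n x. f (?s i)}) (?s l)"
        using x by (intro block_reversal_le(2)) auto
      then show "f \<in> (\<lambda>f. x \<circ> block_rev n {i \<in> descents n x. f (?s i)}) -` ?A"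
        by blast
    qed
  qed simp
  also have "\<dots> = measure_pmf.prob (ungarian_step p (weak_order n) x) ?A"
    unfolding ungarian_step_weak_order[OF x] by simp
  finally show ?thesis .
qed

text \<open>Cells never appear, so the new potential is a sum over the fixed set
  \<open>cells n x\<close> with survival indicators. By linearity only single survival probabilities
  matter: at most \<open>1 - p\<close> at a corner and at most 1 elsewhere.\<close>

lemma potential_drift:
  assumes x: "x permutes {1..n}" and p: "0 \<le> p" "p \<le> 1"
  shows "(\<integral>\<^sup>+y. ennreal (potential n y) \<partial>measure_pmf (ungarian_step p (weak_order n) x)) \<le>
    ennreal (1 - p / 4) * ennreal (potential n x)"
proof -
  let ?K = "ungarian_step p (weak_order n) x"
  let ?W = "\<lambda>(k :: nat, i, j). 2 ^ (i + j) :: real"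
  let ?q = "\<lambda>c. measure_pmf.prob ?K {y. c \<in> cells n y}"
  have W: "0 \<le> ?W c" for c
    by (cases c) auto
  have pot: "potential n y = (\<Sum>c\<in>cells n x. ?W c * indicator {y. c \<in> cells n y} y)" if "y \<in> set_pmf ?K" for y
  proof -
    from x that obtain T where T: "T \<subseteq> descents n x" "y = x \<circ> block_rev n T"
      by (rule set_pmf_ungarian_step)
    then have "block_reversal n T (block_rev n T)"
      using descents_subset by (intro block_reversal_block_rev) blast
    then have "cells n y \<subseteq> cells n x"
      unfolding T(2) using x T(1) by (intro cells_mono block_reversal_le(1))
    then have "potential n y = (\<Sum>c\<in>cells n x. if c \<in> cells n y then ?W c else 0)"
      unfolding potential_def by (simp add: sum.If_cases finite_cells Int_absorb1)
    then show ?thesis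
      by (auto intro!: sum.cong)
  qed
  have "(\<integral>\<^sup>+y. ennreal (potential n y) \<partial>?K) =
      (\<integral>\<^sup>+y. (\<Sum>c\<in>cells n x. ennreal (?W c) * indicator {y. c \<in> cells n y} y) \<partial>?K)"
  proof (rule nn_integral_cong_AE, unfold AE_measure_pmf_iff, rule ballI)
    fix y
    assume "y \<in> set_pmf ?K"
    have "(\<Sum>c\<in>cells n x. ennreal (?W c) * indicator {y. c \<in> cells n y} y) =
        (\<Sum>c\<in>cells n x. ennreal (?W c * indicator {y. c \<in> cells n y} y))"
      by (intro sum.cong refl) (auto simp: indicator_def)
    also have "\<dots> = ennreal (\<Sum>c\<in>cells n x. ?W c * indicator {y. c \<in> cells n y} y)"
      using W by (intro sum_ennreal) auto
    finally show "ennreal (potential n y) = (\<Sum>c\<in>cells n x. ennreal (?W c) * indicator {y. c \<in> cells n y} y)"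
      unfolding pot[OF \<open>y \<in> set_pmf ?K\<close>] by simp
  qed
  also have "\<dots> = (\<Sum>c\<in>cells n x. ennreal (?W c) * emeasure ?K {y. c \<in> cells n y})"
    by (subst nn_integral_sum) (auto intro!: sum.cong nn_integral_cmult_indicator)
  also have "\<dots> = ennreal (\<Sum>c\<in>cells n x. ?W c * ?q c)"
    using W by (simp add: measure_pmf.emeasure_eq_measure flip: ennreal_mult sum_ennreal)
  also have "(\<Sum>c\<in>cells n x. ?W c * ?q c) \<le> (1 - p / 4) * potential n x"
  proof -
    have "(\<Sum>c\<in>cells n x. ?W c * ?q c) \<le> (\<Sum>c\<in>cells n x. ?W c - (if c \<in> corners n x then p * ?W c else 0))"
    proof (intro sum_mono)
      fix c
      show "?W c * ?q c \<le> ?W c - (if c \<in> corners n x then p * ?W c else 0)"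
      proof (cases "c \<in> corners n x")
        case True
        then obtain k l where c: "c = (k, left_large k l x, right_small n k l x)"
          and l: "l \<in> descents n x" "x (Suc l) \<le> k" "k < x l"
          by (auto simp: corners_def)
        let ?A = "{y. (weak_cover n)\<^sup>*\<^sup>* y (x \<circ> Transposition.transpose l (Suc l))}"
        have "?q c \<le> measure_pmf.prob ?K (- ?A)"
          using corner_notin_cells[OF l] unfolding c by (intro measure_pmf.finite_measure_mono) auto
        also have "\<dots> = 1 - measure_pmf.prob ?K ?A"
          using measure_pmf.prob_compl[of ?A ?K] by (simp add: Compl_eq_Diff_UNIV)
        also have "\<dots> \<le> 1 - p"
          using prob_descent_chosen[OF x l(1) p] by simp
        finally have "?W c * ?q c \<le> ?W c * (1 - p)"
          using W by (rule mult_left_mono)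
        with True show ?thesis
          by (simp add: algebra_simps)
      next
        case False
        have "?W c * ?q c \<le> ?W c * 1"
          using W by (intro mult_left_mono) auto
        with False show ?thesis
          by simp
      qed
    qed
    also have "\<dots> = potential n x - p * (\<Sum>c\<in>corners n x. ?W c)"
      using corners_subset_cells[OF x]
      by (simp add: sum_subtractf potential_def sum.If_cases finite_cells Int_absorb1 sum_distrib_left)
    also have "p * potential n x \<le> p * (4 * (\<Sum>c\<in>corners n x. ?W c))"
      using potential_le_corners[OF x] p(1) by (rule mult_left_mono)
    then have "potential n x - p * (\<Sum>c\<in>corners n x. ?W c) \<le> (1 - p / 4) * potential n x"
      by (simp add: algebra_simps)
    finally show ?thesis .
  qed
  also have "ennreal ((1 - p / 4) * potential n x) = ennreal (1 - p / 4) * ennreal (potential n x)"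
    using p W by (intro ennreal_mult) (auto simp: potential_def intro!: sum_nonneg)
  finally show ?thesis
    by (simp add: ennreal_leI)
qed

text \<open>The terms are bounded by 1 until \<open>c ^ k * M\<close> has dropped to 1, and only
  then by a geometric series. The plain geometric bound \<open>M / (1 - c)\<close> would be
  exponentially large in the application.\<close>

lemma suminf_le_geometric:
  fixes u :: "nat \<Rightarrow> ennreal"
  assumes "\<And>t. u t \<le> 1" "\<And>t. u t \<le> ennreal (c ^ t * M)" "0 < c" "c < 1" "c ^ k * M \<le> 1"
  shows "(\<Sum>t. u t) \<le> ennreal (real k + 1 / (1 - c))"
proof -
  let ?v = "\<lambda>t. if t < k then 1 else c ^ (t - k)"
  have "(\<lambda>t. ?v (t + k)) sums (1 / (1 - c))"
    using geometric_sums[of c] assms by simp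
  then have "?v sums (1 / (1 - c) + (\<Sum>t<k. ?v t))"
    by (rule sums_iff_shift[of ?v k "1 / (1 - c)", THEN iffD1])
  then have v: "?v sums (real k + 1 / (1 - c))"
    by (simp add: add.commute)
  have "u t \<le> ennreal (?v t)" for t
  proof (cases "t < k")
    case False
    then have "c ^ t * M = c ^ (t - k) * (c ^ k * M)"
      by (simp add: power_add[symmetric])
    also have "\<dots> \<le> c ^ (t - k) * 1"
      using assms by (intro mult_left_mono) auto
    finally show ?thesis
      using assms(2)[of t] False by (auto intro: order.trans ennreal_leI)
  qed (use assms(1) in simp)
  then have "(\<Sum>t. u t) \<le> (\<Sum>t. ennreal (?v t))"
    by (intro suminf_le summableI)
  also have "\<dots> = ennreal (\<Sum>t. ?v t)"
    using assms v by (intro suminf_ennreal2) (auto simp: sums_iff)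
  also have "(\<Sum>t. ?v t) = real k + 1 / (1 - c)"
    using v by (simp add: sums_iff)
  finally show ?thesis .
qed

lemma ungarian_expected_steps_le:
  assumes p: "0 < p" "p < 1"
  shows "ungarian_expected_steps p (weak_order n) \<le> ennreal (20 / p * real n + 1 + 4 / p)"
proof -
  let ?K = "ungarian_step p (weak_order n)"
  let ?X = "chain_pmf ?K (reverse_perm n)"
  let ?M = "potential n (reverse_perm n)"
  \<comment> \<open>Chosen so that \<open>p / 4 * k\<close> is at least \<open>5 * n\<close>: the
    decay over \<open>k\<close> steps then offsets the initial potential
    \<open>exp (5 * n)\<close>.\<close>
  define k where "k = nat \<lceil>20 / p * real n\<rceil>"
  have M: "0 \<le> ?M"
    unfolding potential_def by (intro sum_nonneg) auto
  have "(\<Sum>t. emeasure (measure_pmf (?X t)) (- {id})) \<le> ennreal (real k + 1 / (1 - (1 - p / 4)))"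
  proof (rule suminf_le_geometric)
    fix t
    show "emeasure (measure_pmf (?X t)) (- {id}) \<le> 1"
      by (rule measure_pmf.emeasure_le_1)
    have perm: "set_pmf (?X t) \<subseteq> {w. w permutes {1..n}}"
      by (induction t) (auto simp: reverse_perm_permutes intro: ungarian_step_permutes)
    have "emeasure (measure_pmf (?X t)) (- {id}) = (\<integral>\<^sup>+y. indicator (- {id}) y \<partial>measure_pmf (?X t))"
      by simp
    also have "\<dots> \<le> (\<integral>\<^sup>+y. ennreal (potential n y) \<partial>measure_pmf (?X t))"
    proof (rule nn_integral_mono_AE, unfold AE_measure_pmf_iff, rule ballI)
      fix y
      assume "y \<in> set_pmf (?X t)"
      then show "indicator (- {id}) y \<le> ennreal (potential n y)"
        using perm potential_ge_1[of y n] by (auto simp: indicator_def)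
    qed
    also have "\<dots> \<le> ennreal (1 - p / 4) ^ t * ennreal ?M"
      using p by (intro nn_integral_chain_drift[where S = "{w. w permutes {1..n}}"])
        (auto simp: reverse_perm_permutes intro: ungarian_step_permutes intro!: potential_drift)
    also have "\<dots> = ennreal ((1 - p / 4) ^ t * ?M)"
      using p M by (simp add: ennreal_mult ennreal_power)
    finally show "emeasure (measure_pmf (?X t)) (- {id}) \<le> ennreal ((1 - p / 4) ^ t * ?M)" .
  next
    have "20 / p * real n \<le> real k"
      unfolding k_def by (rule real_nat_ceiling_ge)
    then have "5 * real n \<le> p / 4 * real k"
      using p by (simp add: field_simps)
    have "(1 - p / 4) ^ k \<le> exp (- (p / 4)) ^ k"
      using p exp_ge_add_one_self[of "- (p / 4)"] by (intro power_mono) auto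
    also have "\<dots> = exp (- (p / 4 * real k))"
      by (simp add: exp_of_nat_mult[symmetric] mult.commute)
    also have "\<dots> \<le> exp (- (5 * real n))"
      using \<open>5 * real n \<le> p / 4 * real k\<close> by simp
    finally have "(1 - p / 4) ^ k * ?M \<le> exp (- (5 * real n)) * exp (5 * real n)"
      using M by (intro mult_mono potential_le) auto
    then show "(1 - p / 4) ^ k * ?M \<le> 1"
      by (simp add: exp_add[symmetric])
  qed (use p in auto)
  also have "real k \<le> 20 / p * real n + 1"
    using p unfolding k_def by simp
  then have "ennreal (real k + 1 / (1 - (1 - p / 4))) \<le> ennreal (20 / p * real n + 1 + 4 / p)"
    by (intro ennreal_leI) simp
  finally show ?thesis
    unfolding ungarian_expected_steps_def top_weak_order bottom_weak_order
    by (rule order.trans[OF nn_integral_hitting_time_le])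
qed

section \<open>Lower bound for the expected number of steps\<close>

lemma smallo_cube_power:
  fixes p :: real
  assumes "0 < p" "p < 1"
  shows "(\<lambda>n. - (real n ^ 3 * p ^ (n - 1))) \<in> o(\<lambda>_. 1)"
  using assms by real_asymp

text \<open>Without the jump from the top to the bottom, whose probability is exponentially small, \<open>length_ge\<close> bounds the number of steps of every trajectory.\<close>

definition reachable :: "nat \<Rightarrow> nat \<Rightarrow> (nat \<Rightarrow> nat) \<Rightarrow> bool" where
  "reachable n t y \<longleftrightarrow> (\<exists>x T. x 0 = reverse_perm n \<and> x t = y \<and>
     (\<forall>s<t. T s \<subseteq> descents n (x s) \<and> x (Suc s) = x s \<circ> block_rev n (T s) \<and>
       \<not> (x s = reverse_perm n \<and> x (Suc s) = id)))"

lemma reachable_0: "reachable n 0 (reverse_perm n)"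
  unfolding reachable_def by (rule exI[of _ "\<lambda>_. reverse_perm n"]) simp

lemma reachable_Suc:
  assumes y: "reachable n t y" and T: "T \<subseteq> descents n y"
    and "\<not> (y = reverse_perm n \<and> y \<circ> block_rev n T = id)"
  shows "reachable n (Suc t) (y \<circ> block_rev n T)"
proof -
  from y obtain x S where x: "x 0 = reverse_perm n" "x t = y"
    "\<And>s. s < t \<Longrightarrow> S s \<subseteq> descents n (x s) \<and> x (Suc s) = x s \<circ> block_rev n (S s) \<and>
       \<not> (x s = reverse_perm n \<and> x (Suc s) = id)"
    unfolding reachable_def by blast
  let ?x = "x(Suc t := y \<circ> block_rev n T)" and ?S = "S(t := T)"
  have "?S s \<subseteq> descents n (?x s) \<and> ?x (Suc s) = ?x s \<circ> block_rev n (?S s) \<and>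
       \<not> (?x s = reverse_perm n \<and> ?x (Suc s) = id)" if "s < Suc t" for s
  proof (cases "s = t")
    case True
    then show ?thesis
      using x(2) T assms(3) by simp
  next
    case False
    then have eq: "?x s = x s" "?x (Suc s) = x (Suc s)" "?S s = S s" and "s < t"
      using that by auto
    then show ?thesis
      unfolding eq by (intro x(3))
  qed
  note step = this
  show ?thesis
    unfolding reachable_def
  proof (intro exI conjI)
    show "?x 0 = reverse_perm n" "?x (Suc t) = y \<circ> block_rev n T"
      using x(1) by auto
    show "\<forall>s<Suc t. ?S s \<subseteq> descents n (?x s) \<and> ?x (Suc s) = ?x s \<circ> block_rev n (?S s) \<and>
       \<not> (?x s = reverse_perm n \<and> ?x (Suc s) = id)"
      using step by blast
  qed
qed

lemma reachable_id_imp: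
  assumes "reachable n t id" "2 \<le> n"
  shows "n \<le> t + 1"
proof -
  from assms(1) obtain x T where x: "x 0 = reverse_perm n" "x t = id"
    "\<And>s. s < t \<Longrightarrow> T s \<subseteq> descents n (x s) \<and> x (Suc s) = x s \<circ> block_rev n (T s) \<and>
       \<not> (x s = reverse_perm n \<and> x (Suc s) = id)"
    unfolding reachable_def by blast
  interpret ungarian_path n t x T "\<lambda>s. block_rev n (T s)"
  proof
    show "block_reversal n (T s) (block_rev n (T s))" if "s < t" for s
      using x(3)[OF that] descents_subset by (intro block_reversal_block_rev) blast
    show "T s \<subseteq> descents n (x s)" "x (Suc s) = x s \<circ> block_rev n (T s)"
      "\<not> (x s = reverse_perm n \<and> x (Suc s) = id)" if "s < t" for s
      using x(3)[OF that] by blast+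
    show "x 0 = reverse_perm n" "x t = id"
      by fact+
  qed
  \<comment> \<open>The left side is \<open>n\<close> or \<open>n - 1\<close> according to
    parity.\<close>
  have "2 * (n div 2) \<le> t"
    using assms(2) by (rule length_ge)
  then show ?thesis
    by linarith
qed

lemma reachable_permutes:
  assumes "reachable n t y"
  shows "y permutes {1..n}"
proof -
  from assms obtain x T where x: "x 0 = reverse_perm n" "x t = y"
    "\<And>s. s < t \<Longrightarrow> T s \<subseteq> descents n (x s) \<and> x (Suc s) = x s \<circ> block_rev n (T s)"
    unfolding reachable_def by blast
  have "x s permutes {1..n}" if "s \<le> t" for s
    using that
  proof (induction s)
    case 0
    then show ?case
      by (simp add: x(1) reverse_perm_permutes)
  next
    case (Suc s)
    have "T s \<subseteq> {1..<n}"
      using x(3)[of s] Suc.prems descents_subset[of n "x s"] by auto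
    then have "block_rev n (T s) permutes {1..n}"
      using block_reversal_block_rev block_reversal_permutes by blast
    then have "x s \<circ> block_rev n (T s) permutes {1..n}"
      using Suc by (intro permutes_compose) auto
    with x(3)[of s] Suc.prems show ?case
      by (simp only: Suc_le_eq)
  qed
  then show ?thesis
    using x(2) by blast
qed

text \<open>The jump reverses the order of the positions 1 and \<open>n\<close>, so every gap must
  be chosen and all \<open>n - 1\<close> coins must succeed.\<close>

lemma pmf_jump_le:
  assumes n: "2 \<le> n" and p: "0 \<le> p" "p \<le> 1"
  shows "pmf (ungarian_step p (weak_order n) (reverse_perm n)) id \<le> p ^ (n - 1)"
proof -
  let ?w = "reverse_perm n"
  let ?s = "\<lambda>i. ?w \<circ> Transposition.transpose i (Suc i)"
  let ?C = "covered_set (weak_order n) ?w"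
  let ?P = "Pi_pmf ?C False (\<lambda>_. bernoulli_pmf p)"
  let ?Y = "\<lambda>f. ?w \<circ> block_rev n {i \<in> descents n ?w. f (?s i)}"
  note w = reverse_perm_permutes[of n]
  have D: "descents n ?w = {1..<n}"
    by (auto simp: descents_def reverse_perm_def)
  have C: "?C = ?s ` {1..<n}"
    unfolding covered_set_weak_order[OF w] D ..
  have "?Y -` {id} \<subseteq> Pi ?C (\<lambda>_. {True})"
  proof
    fix f
    assume "f \<in> ?Y -` {id}"
    then have Y: "?Y f = id"
      by blast
    let ?T = "{i \<in> descents n ?w. f (?s i)}"
    have b: "block_reversal n ?T (block_rev n ?T)"
      using descents_subset by (intro block_reversal_block_rev) blast
    have "?w (block_rev n ?T i) = i" for i
      using fun_cong[OF Y, of i] by simp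
    then have "block_rev n ?T i = ?w i" for i
      by (metis reverse_perm_invol)
    then have "block_rev n ?T n < block_rev n ?T 1"
      using n by (simp add: reverse_perm_def)
    then have "{1..<n} \<subseteq> ?T"
      using block_reversal_less[OF b, of 1 n] n by simp
    then show "f \<in> Pi ?C (\<lambda>_. {True})"
      unfolding C by auto
  qed
  then have "measure_pmf.prob ?P (?Y -` {id}) \<le> measure_pmf.prob ?P (Pi ?C (\<lambda>_. {True}))"
    by (intro measure_pmf.finite_measure_mono) auto
  also have "\<dots> = p ^ card ?C"
    using p by (subst measure_Pi_pmf_Pi) (auto simp: finite_covered_set[OF w] measure_pmf_single)
  also have "card ?C = n - 1"
    unfolding C by (subst card_image) (auto intro: inj_transpose_Suc permutes_inj[OF w])
  finally show ?thesis
    unfolding ungarian_step_weak_order[OF w] by (simp only: pmf_map)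
qed

text \<open>A step from a reachable state to an unreachable one can only be the jump, so each step
  adds at most the probability of the jump.\<close>

lemma emeasure_not_reachable:
  assumes n: "2 \<le> n" and p: "0 \<le> p" "p \<le> 1"
  shows "emeasure (chain_pmf (ungarian_step p (weak_order n)) (reverse_perm n) t) {y. \<not> reachable n t y}
    \<le> ennreal (real t * p ^ (n - 1))"
proof (induction t)
  case 0
  show ?case
    by (simp add: reachable_0 indicator_def)
next
  case (Suc t)
  let ?K = "ungarian_step p (weak_order n)"
  let ?X = "chain_pmf ?K (reverse_perm n)"
  let ?B = "\<lambda>t. {y. \<not> reachable n t y}"
  have K: "emeasure (?K y) (?B (Suc t)) \<le> ennreal (p ^ (n - 1))" if y: "reachable n t y" for y
  proof -
    have perm: "y permutes {1..n}"
      using y by (rule reachable_permutes)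
    have *: "y = reverse_perm n \<and> z = id" if "z \<in> set_pmf (?K y)" "z \<in> ?B (Suc t)" for z
    proof -
      from perm that(1) obtain T where T: "T \<subseteq> descents n y" "z = y \<circ> block_rev n T"
        by (rule set_pmf_ungarian_step)
      show ?thesis
        using reachable_Suc[OF y T(1)] that(2) unfolding T(2) by blast
    qed
    have "emeasure (?K y) (?B (Suc t)) = emeasure (?K y) (?B (Suc t) \<inter> set_pmf (?K y))"
      by (rule emeasure_Int_set_pmf[symmetric])
    also have "\<dots> \<le> ennreal (p ^ (n - 1))"
    proof (cases "y = reverse_perm n")
      case True
      have "emeasure (?K y) (?B (Suc t) \<inter> set_pmf (?K y)) \<le> emeasure (?K y) {id}"
        using * by (intro emeasure_mono) auto
      also have "\<dots> \<le> ennreal (p ^ (n - 1))"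
        unfolding True by (simp add: emeasure_pmf_single pmf_jump_le[OF n p] ennreal_leI)
      finally show ?thesis .
    next
      case False
      then have empty: "?B (Suc t) \<inter> set_pmf (?K y) = {}"
        using * by blast
      show ?thesis
        unfolding empty by simp
    qed
    finally show ?thesis .
  qed
  have "emeasure (?X (Suc t)) (?B (Suc t)) = (\<integral>\<^sup>+y. emeasure (?K y) (?B (Suc t)) \<partial>?X t)"
    by (simp add: emeasure_bind_pmf)
  also have "\<dots> \<le> (\<integral>\<^sup>+y. indicator (?B t) y + ennreal (p ^ (n - 1)) \<partial>?X t)"
  proof (rule nn_integral_mono)
    fix y
    show "emeasure (?K y) (?B (Suc t)) \<le> indicator (?B t) y + ennreal (p ^ (n - 1))"
    proof (cases "reachable n t y")
      case True
      then show ?thesis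
        using K by simp
    next
      case False
      have "emeasure (?K y) (?B (Suc t)) \<le> 1 + 0"
        by (simp add: measure_pmf.emeasure_le_1)
      also have "\<dots> \<le> indicator (?B t) y + ennreal (p ^ (n - 1))"
        using False by (intro add_mono) auto
      finally show ?thesis .
    qed
  qed
  also have "\<dots> = emeasure (?X t) (?B t) + ennreal (p ^ (n - 1))"
    by (subst nn_integral_add) auto
  also have "\<dots> \<le> ennreal (real t * p ^ (n - 1)) + ennreal (p ^ (n - 1))"
    by (intro add_right_mono Suc.IH)
  also have "\<dots> = ennreal (real (Suc t) * p ^ (n - 1))"
    using p by (simp add: algebra_simps flip: ennreal_plus)
  finally show ?case .
qed

text \<open>The cube collects three factors of at most \<open>n\<close>: the number of steps in
  which a jump may occur, the number of times in the union bound, and the value \<open>n - 1\<close>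
  of the time that is lost.\<close>

lemma ungarian_expected_steps_ge:
  assumes n: "2 \<le> n" and p: "0 \<le> p" "p \<le> 1"
  shows "ennreal (real n - 1 - real n ^ 3 * p ^ (n - 1)) \<le> ungarian_expected_steps p (weak_order n)"
proof -
  let ?K = "ungarian_step p (weak_order n)"
  let ?X = "chain_pmf ?K (reverse_perm n)"
  let ?q = "p ^ (n - 1)"
  have "pmf (?X t) id \<le> real n * ?q" if t: "t < n - 1" for t
  proof -
    have "{id} \<subseteq> {y. \<not> reachable n t y}"
      using reachable_id_imp[OF _ n, of t] t by auto
    then have "emeasure (?X t) {id} \<le> emeasure (?X t) {y. \<not> reachable n t y}"
      by (intro emeasure_mono) auto
    also have "\<dots> \<le> ennreal (real t * ?q)"
      by (rule emeasure_not_reachable[OF n p])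
    finally have "pmf (?X t) id \<le> real t * ?q"
      using p by (simp add: emeasure_pmf_single)
    also have "\<dots> \<le> real n * ?q"
      using t p by (intro mult_right_mono) auto
    finally show ?thesis .
  qed
  then have "(\<Sum>t<n - 1. pmf (?X t) id) \<le> (\<Sum>t<n - 1. real n * ?q)"
    by (intro sum_mono) auto
  also have "\<dots> \<le> real n * (real n * ?q)"
    using p by (simp add: mult_right_mono)
  finally have "real (n - 1) * (\<Sum>t<n - 1. pmf (?X t) id) \<le> real n * (real n * (real n * ?q))"
    by (intro mult_mono) (auto intro: sum_nonneg)
  then have "real n - 1 - real n ^ 3 * ?q \<le> real (n - 1) * (1 - (\<Sum>t<n - 1. pmf (?X t) id))"
    using n by (simp add: algebra_simps power3_eq_cube)
  then have "ennreal (real n - 1 - real n ^ 3 * ?q) \<le> ennreal (real (n - 1) * (1 - (\<Sum>t<n - 1. pmf (?X t) id)))"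
    by (rule ennreal_leI)
  also have "\<dots> \<le> ungarian_expected_steps p (weak_order n)"
    unfolding ungarian_expected_steps_def top_weak_order bottom_weak_order
    by (rule nn_integral_hitting_time_ge)
  finally show ?thesis .
qed

theorem theorem1p9:
  fixes p :: real
  assumes "0 < p" and "p < 1"
  shows "\<exists>f g :: nat \<Rightarrow> real. f \<in> o(\<lambda>_. 1) \<and> g \<in> O(\<lambda>n. real n) \<and>
    (\<forall>\<^sub>F n in sequentially.
       ereal (real n - 1 + f n) \<le> enn2ereal (ungarian_expected_steps p (weak_order n)) \<and>
       enn2ereal (ungarian_expected_steps p (weak_order n))
         \<le> ereal (8 / p * real n * ln (real n) + g n))"
proof (intro exI conjI)
  let ?f = "\<lambda>n. - (real n ^ 3 * p ^ (n - 1))" and ?g = "\<lambda>n. 20 / p * real n + 1 + 4 / p"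
  show "?f \<in> o(\<lambda>_. 1)"
    using assms by (rule smallo_cube_power)
  show "?g \<in> O(\<lambda>n. real n)"
    by real_asymp
  show "\<forall>\<^sub>F n in sequentially.
       ereal (real n - 1 + ?f n) \<le> enn2ereal (ungarian_expected_steps p (weak_order n)) \<and>
       enn2ereal (ungarian_expected_steps p (weak_order n))
         \<le> ereal (8 / p * real n * ln (real n) + ?g n)"
    using eventually_ge_at_top[of 2]
  proof eventually_elim
    case (elim n)
    let ?E = "ungarian_expected_steps p (weak_order n)"
    \<comment> \<open>For small \<open>n\<close> the left side may be negative, and
      \<open>ennreal\<close> then cuts it off at 0; hence an inequality.\<close>
    have "ereal (real n - 1 + ?f n) \<le> enn2ereal (ennreal (real n - 1 + ?f n))"
      by (simp add: ennreal.rep_eq)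
    also have "\<dots> \<le> enn2ereal ?E"
      using ungarian_expected_steps_ge[OF elim, of p] assms by (simp add: less_eq_ennreal.rep_eq)
    finally have lower: "ereal (real n - 1 + ?f n) \<le> enn2ereal ?E" .
    have "enn2ereal ?E \<le> enn2ereal (ennreal (?g n))"
      using ungarian_expected_steps_le[OF assms, of n] by (simp add: less_eq_ennreal.rep_eq)
    also have "\<dots> = ereal (?g n)"
      using assms by (intro enn2ereal_ennreal) simp
    also have "\<dots> \<le> ereal (8 / p * real n * ln (real n) + ?g n)"
      using assms elim by simp
    finally show ?case
      using lower by blast
  qed
qed

end
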